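(* Let $\nu>-1$. Then for every integer $n\ge1$, $$\sum_{k \ge 1} \frac{\big(j_k^{\nu}\big)^2}{\Big[\big(j_n^{\nu+1}\big)^2-\big(j_k^{\nu}\big)^2\Big]^2} = \frac{1}{4}.$$
   Context: For $\mu>-1$, $\{j_n^{\mu}: n\ge1\}$ denotes the sequence of strictly positive zeros, in ascending order, of the Bessel function of the first kind $J_\mu$. *)

theory Defs
  imports "HOL-Analysis.Analysis"
begin

(* Power series of the Bessel function of the first kind of real order mu.  It is meant for x > 0
   (powr is not the intended power for x <= 0).  With rGamma = 1/Gamma, terms at poles
   of Gamma vanish, so the formula is correct for every real mu. *)
definition bessel_J :: "real \<Rightarrow> real \<Rightarrow> real" where
  "bessel_J \<mu> x =
     (\<Sum>m. (- 1) ^ m * rGamma (real m + \<mu> + 1) / fact m * (x / 2) powr (2 * real m + \<mu>))"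

(* For n >= 1, bessel_zero mu n is the n-th strictly positive zero of J_mu; the value 0 at
   n = 0 only starts the recursion. *)
primrec bessel_zero :: "real \<Rightarrow> nat \<Rightarrow> real" where
  "bessel_zero \<mu> 0 = 0"
| "bessel_zero \<mu> (Suc n) = (LEAST x. bessel_zero \<mu> n < x \<and> bessel_J \<mu> x = 0)"

end

theory Submission
  imports Defs "HOL-Computational_Algebra.Fundamental_Theorem_Algebra"
begin

text \<open>
For \<open>x > 0\<close>, \<open>J\<^sub>\<nu>(x)\<close> is a zero-free factor times \<open>h(x\<^sup>2 / 4)\<close>, where \<open>h = \<^sub>0F\<^sub>1(; a; -y)\<close> with \<open>a = \<nu> + 1\<close> is
entire and satisfies \<open>y h'' + a h' + h = 0\<close>. Its derivative is a multiple of the same function for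
\<open>a + 1\<close>, so \<open>b = (j\<^sub>n\<^sup>\<nu>\<^sup>+\<^sup>1)\<^sup>2 / 4\<close> is a critical point of \<open>h\<close>. Let \<open>x\<^sub>k\<close> be the zeros of \<open>h\<close>. If
\<open>h' / h = \<Sum> 1 / (y - x\<^sub>k)\<close>, then differentiation and evaluation at \<open>b\<close> give \<open>\<Sum> 1 / (b - x\<^sub>k) = 0\<close> and
\<open>\<Sum> 1 / (b - x\<^sub>k)\<^sup>2 = - h''(b) / h(b) = 1 / b\<close>, whence \<open>\<Sum> x\<^sub>k / (b - x\<^sub>k)\<^sup>2 = b * (1 / b) - 0 = 1\<close>
(\<open>clifford_zero_sum\<close>). Rescaling by \<open>4\<close> turns this into the claim.

The work lies in the partial fraction expansion with exactly the positive zeros of \<open>h\<close> as poles,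
and it is obtained without a general factorisation theorem for entire functions. The function \<open>h\<close> is
a limit of polynomials that arise from \<open>(1 - x) ^ N\<close> by operators \<open>p \<mapsto> b p + x p'\<close> with \<open>b > 0\<close>. These
operators preserve the property that all complex roots are positive reals (\<open>pos_rooted_euler_op\<close>).
The reciprocals of the roots are nonnegative with bounded sum, so in decreasing order the \<open>k\<close>-th one
is \<open>O(1/k)\<close>. A subsequence converges termwise, and dominated convergence passes the logarithmic
derivative and its derivative to the limit, up to one unknown constant \<open>d \<ge> 0\<close> in the former
(\<open>partial_fractions\<close>).

The differential equation supplies the rest (\<open>clifford_reciprocal_zeros\<close>). Read as a Riccati equation
for \<open>h' / h\<close> on the negative axis, it shows that \<open>d = 0\<close> and that there are infinitely many zeros. It
also makes all zeros simple, so comparing double poles shows that every positive zero of \<open>h\<close> occurs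
exactly once in the expansion (\<open>double_pole_count\<close>).
\<close>

section \<open>Real polynomials with only positive real roots\<close>
definition pos_rooted :: "real poly \<Rightarrow> bool" where
  "pos_rooted p \<longleftrightarrow> p \<noteq> 0 \<and>
     (\<forall>z::complex. poly (map_poly of_real p) z = 0 \<longrightarrow> z \<in> \<real> \<and> 0 < Re z)"

lemma map_poly_of_real_add:
  "map_poly complex_of_real (p + q) = map_poly of_real p + map_poly of_real q"
  by (intro poly_eqI) (simp add: coeff_map_poly)

lemma map_poly_of_real_smult:
  "map_poly complex_of_real (smult c p) = smult (of_real c) (map_poly of_real p)"
  by (intro poly_eqI) (simp add: coeff_map_poly)

lemma map_poly_of_real_mult:
  "map_poly complex_of_real (p * q) = map_poly of_real p * map_poly of_real q"
  by (intro poly_eqI) (simp add: coeff_map_poly coeff_mult)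

lemma map_poly_of_real_pderiv:
  "map_poly complex_of_real (pderiv p) = pderiv (map_poly of_real p)"
  by (intro poly_eqI) (simp add: coeff_map_poly coeff_pderiv)

lemmas map_poly_of_real =
  map_poly_of_real_add map_poly_of_real_smult map_poly_of_real_mult map_poly_of_real_pderiv

lemma poly_map_poly_of_real:
  "poly (map_poly complex_of_real p) (of_real x) = of_real (poly p x)"
  by (induction p) (auto simp: map_poly_pCons)

text \<open>Normalising the factors to value \<open>1\<close> at the origin records the reciprocals of the roots. These
stay bounded when the degree grows and roots escape to infinity, which is what the later limit needs.\<close>
lemma pos_rooted_factor:
  assumes "pos_rooted p"
  shows "\<exists>ss. (\<forall>s\<in>set ss. 0 < s) \<and> length ss = degree p \<and>
              p = smult (coeff p 0) (\<Prod>s\<leftarrow>ss. [:1, - s:])"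
  using assms
proof (induction "degree p" arbitrary: p)
  case 0
  then obtain c where "p = [:c:]" by (metis degree_eq_zeroE)
  then show ?case by (intro exI[of _ "[]"]) (auto simp: one_pCons)
next
  case (Suc d)
  let ?P = "map_poly complex_of_real p"
  have deg: "degree ?P = degree p" by (rule degree_map_poly) auto
  have "\<exists>z. poly ?P z = 0"
    using deg Suc.hyps(2) by (intro fundamental_theorem_of_algebra_alt) auto
  then obtain z where z: "poly ?P z = 0" by blast
  with Suc.prems have "z \<in> \<real>" "0 < Re z" by (auto simp: pos_rooted_def)
  then obtain r where r: "z = of_real r" "0 < r" by (auto elim!: Reals_cases)
  with z have "poly p r = 0" by (simp add: poly_map_poly_of_real)
  then obtain q where q: "p = [:-r, 1:] * q" by (auto simp: poly_eq_0_iff_dvd dvd_def)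
  have "q \<noteq> 0" using Suc.prems q by (auto simp: pos_rooted_def)
  then have dq: "degree p = Suc (degree q)" unfolding q by (subst degree_mult_eq) auto
  have "pos_rooted q"
    using Suc.prems \<open>q \<noteq> 0\<close> unfolding pos_rooted_def q map_poly_of_real by auto
  with Suc.hyps dq obtain ss where ss: "\<forall>s\<in>set ss. 0 < s" "length ss = degree q"
      "q = smult (coeff q 0) (\<Prod>s\<leftarrow>ss. [:1, - s:])" by auto
  have c0: "coeff p 0 = coeff q 0 * - r" unfolding q by simp
  have "p = [:-r, 1:] * smult (coeff q 0) (\<Prod>s\<leftarrow>ss. [:1, - s:])"
    using q ss(3) by simp
  also have "[:-r, 1:] = smult (- r) [:1, - (1 / r):]" using r by simp
  also have "\<dots> * smult (coeff q 0) (\<Prod>s\<leftarrow>ss. [:1, - s:])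
      = smult (coeff p 0) (\<Prod>s\<leftarrow>(1/r) # ss. [:1, - s:])"
    unfolding list.map prod_list.Cons c0
    by (simp only: mult_smult_left mult_smult_right smult_smult)
  finally show ?case using r ss dq
    by (intro exI[of _ "(1/r) # ss"]) auto
qed

lemma poly_pderiv_prod_list:
  fixes z :: complex
  assumes "\<forall>s\<in>set ss. 1 - of_real s * z \<noteq> 0"
  shows "z * poly (pderiv (map_poly of_real (\<Prod>s\<leftarrow>ss. [:1, - s:]))) z =
    - poly (map_poly of_real (\<Prod>s\<leftarrow>ss. [:1, - s:])) z *
      (\<Sum>s\<leftarrow>ss. of_real s * z / (1 - of_real s * z))"
  using assms
proof (induction ss)
  case Nil
  then show ?case by (simp add: map_poly_1')
next
  case (Cons s ss)
  define P where "P = map_poly complex_of_real (\<Prod>s\<leftarrow>ss. [:1, - s:])"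
  define S where "S = (\<Sum>s\<leftarrow>ss. of_real s * z / (1 - of_real s * z))"
  have eq: "map_poly complex_of_real (\<Prod>s\<leftarrow>s # ss. [:1, - s:]) = [:1, - of_real s:] * P"
    by (simp add: map_poly_of_real map_poly_pCons P_def del: mult_pCons_left)
  have IH: "z * poly (pderiv P) z = - poly P z * S"
    using Cons unfolding P_def S_def by simp
  have nz: "1 - of_real s * z \<noteq> 0" using Cons.prems by simp
  have "z * poly (pderiv ([:1, - of_real s:] * P)) z
      = (1 - of_real s * z) * (z * poly (pderiv P) z) - of_real s * z * poly P z"
    unfolding pderiv_mult by (simp add: pderiv_pCons algebra_simps del: mult_pCons_left)
  also have "\<dots> = - poly ([:1, - of_real s:] * P) z * (of_real s * z / (1 - of_real s * z) + S)"
    unfolding IH using nz by (simp add: field_simps)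
  finally show ?case unfolding eq by (simp add: S_def)
qed

lemma Re_sum_list: "Re (sum_list xs) = (\<Sum>x\<leftarrow>xs. Re x)" by (induction xs) auto
lemma Im_sum_list: "Im (sum_list xs) = (\<Sum>x\<leftarrow>xs. Im x)" by (induction xs) auto

text \<open>The imaginary part of \<open>s z / (1 - s z)\<close> is \<open>Im z\<close> times a positive number, so in a sum of such
terms nothing cancels and a real value forces \<open>z\<close> to be real. For real \<open>z \<le> 0\<close> no term is positive.\<close>
lemma sum_list_div_eq_pos_imp_real:
  fixes z :: complex
  assumes pos: "\<forall>s\<in>set ss. 0 < s" and nz: "\<forall>s\<in>set ss. 1 - of_real s * z \<noteq> 0"
    and eq: "(\<Sum>s\<leftarrow>ss. of_real s * z / (1 - of_real s * z)) = of_real b" and "0 < b"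
  shows "z \<in> \<real> \<and> 0 < Re z"
proof -
  let ?f = "\<lambda>s. of_real s * z / (1 - of_real s * z)"
  have ne: "ss \<noteq> []" using eq \<open>0 < b\<close> by auto
  have Im: "Im (?f s) = Im z * (s / ((1 - s * Re z)\<^sup>2 + (s * Im z)\<^sup>2))" if "s \<in> set ss" for s
    by (simp add: Im_divide) (simp add: field_simps power2_eq_square)
  define W where "W = (\<Sum>s\<leftarrow>ss. s / ((1 - s * Re z)\<^sup>2 + (s * Im z)\<^sup>2))"
  have "0 = Im (\<Sum>s\<leftarrow>ss. ?f s)" unfolding eq by simp
  also have "\<dots> = (\<Sum>s\<leftarrow>ss. Im z * (s / ((1 - s * Re z)\<^sup>2 + (s * Im z)\<^sup>2)))"
    using Im by (simp add: Im_sum_list o_def cong: map_cong)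
  also have "\<dots> = Im z * (\<Sum>s\<leftarrow>ss. s / ((1 - s * Re z)\<^sup>2 + (s * Im z)\<^sup>2))"
    by (rule sum_list_const_mult)
  also have "\<dots> = Im z * W" by (simp only: W_def)
  finally have zero: "Im z = 0 \<or> W = 0" by simp
  have *: "0 < s / ((1 - s * Re z)\<^sup>2 + (s * Im z)\<^sup>2)" if "0 < s" "1 - of_real s * z \<noteq> 0" for s
  proof -
    have "(1 - s * Re z)\<^sup>2 + (s * Im z)\<^sup>2 \<noteq> 0"
      using that(2) by (auto simp: complex_eq_iff)
    then have "0 < (1 - s * Re z)\<^sup>2 + (s * Im z)\<^sup>2"
      by (simp add: order_less_le)
    with that(1) show ?thesis by simp
  qed
  have "0 < (\<Sum>s\<leftarrow>ss. s / ((1 - s * Re z)\<^sup>2 + (s * Im z)\<^sup>2))"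
    using ne pos nz
  proof (induction ss rule: list_nonempty_induct)
    case (cons x xs)
    then show ?case using *[of x] by (auto intro!: add_pos_pos)
  qed (use * in auto)
  then have "Im z = 0" using zero unfolding W_def by linarith
  then obtain x where z: "z = of_real x" by (metis complex_is_Real_iff Reals_cases)
  have Re: "Re (?f s) = s * x / (1 - s * x)" for s
  proof -
    have "?f s = of_real (s * x / (1 - s * x))" unfolding z by simp
    then show ?thesis by (simp only: Re_complex_of_real)
  qed
  have "0 < x"
  proof (rule ccontr)
    assume "\<not> 0 < x"
    have "Re (?f s) \<le> 0" if "s \<in> set ss" for s
    proof -
      have "s * x \<le> 0" using pos that \<open>\<not> 0 < x\<close>
        by (intro mult_nonneg_nonpos) (auto intro: less_imp_le)
      then show ?thesis unfolding Re by (intro divide_nonpos_pos) linarith+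
    qed
    then have "(\<Sum>s\<leftarrow>ss. Re (?f s)) \<le> 0" by (intro sum_list_nonpos) auto
    moreover have "(\<Sum>s\<leftarrow>ss. Re (?f s)) = b"
      using arg_cong[OF eq, of Re] by (simp add: Re_sum_list o_def)
    ultimately show False using \<open>0 < b\<close> by simp
  qed
  with z show ?thesis by simp
qed

text \<open>A Gauss--Lucas type argument: a zero \<open>z\<close> of \<open>b p + z p'\<close> that is not a zero of \<open>p\<close> satisfies
\<open>z p'(z) / p(z) = - b\<close>, which by the factorisation of \<open>p\<close> is the equation treated in
\<open>sum_list_div_eq_pos_imp_real\<close>.\<close>
lemma pos_rooted_euler_op:
  assumes "pos_rooted p" "0 < b"
  shows "pos_rooted (smult b p + [:0, 1:] * pderiv p)"
proof -
  obtain ss where ss: "\<forall>s\<in>set ss. 0 < s" "p = smult (coeff p 0) (\<Prod>s\<leftarrow>ss. [:1, - s:])"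
    using pos_rooted_factor[OF assms(1)] by blast
  define P where "P = map_poly complex_of_real p"
  define Q where "Q = map_poly complex_of_real (\<Prod>s\<leftarrow>ss. [:1, - s:])"
  have PQ: "P = smult (of_real (coeff p 0)) Q"
    unfolding P_def Q_def by (subst ss(2)) (simp add: map_poly_of_real)
  have c0: "coeff p 0 \<noteq> 0" using ss(2) assms(1) by (auto simp: pos_rooted_def)
  have Proot: "z \<in> \<real> \<and> 0 < Re z" if "poly P z = 0" for z
    using that assms(1) by (simp add: pos_rooted_def P_def)
  have "z \<in> \<real> \<and> 0 < Re z"
    if "poly (map_poly of_real (smult b p + [:0, 1:] * pderiv p)) z = 0" for z :: complex
  proof (cases "poly P z = 0 \<or> (\<exists>s\<in>set ss. 1 - of_real s * z = 0)")
    case True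
    then show ?thesis
    proof
      assume "\<exists>s\<in>set ss. 1 - of_real s * z = 0"
      then obtain s where s: "s \<in> set ss" "of_real s * z = 1" by auto
      then have "s > 0" using ss by auto
      then have "z = of_real (1 / s)" using s by (simp add: field_simps)
      then show ?thesis using \<open>s > 0\<close> by (metis Re_complex_of_real Reals_of_real zero_less_divide_1_iff)
    qed (rule Proot)
  next
    case False
    have "0 = of_real b * poly P z + z * poly (pderiv P) z"
      using that by (simp add: map_poly_of_real P_def map_poly_pCons del: mult_pCons_left)
    also have "z * poly (pderiv P) z = of_real (coeff p 0) * (z * poly (pderiv Q) z)"
      by (simp add: PQ pderiv_smult)
    also have "z * poly (pderiv Q) z = - poly Q z *
        (\<Sum>s\<leftarrow>ss. of_real s * z / (1 - of_real s * z))"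
      unfolding Q_def using False by (intro poly_pderiv_prod_list) auto
    finally have "0 = of_real b * poly P z + of_real (coeff p 0) *
        (- poly Q z * (\<Sum>s\<leftarrow>ss. of_real s * z / (1 - of_real s * z)))" .
    also have "\<dots> = poly P z * (of_real b - (\<Sum>s\<leftarrow>ss. of_real s * z / (1 - of_real s * z)))"
      unfolding PQ poly_smult by (simp add: right_diff_distrib mult.assoc mult.left_commute)
    finally have "poly P z * (of_real b - (\<Sum>s\<leftarrow>ss. of_real s * z / (1 - of_real s * z))) = 0"
      by (rule sym)
    then have "(\<Sum>s\<leftarrow>ss. of_real s * z / (1 - of_real s * z)) = of_real b"
      using False by auto
    then show ?thesis using False ss(1) assms(2)
      by (intro sum_list_div_eq_pos_imp_real) auto
  qed
  moreover have "smult b p + [:0, 1:] * pderiv p \<noteq> 0"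
  proof
    assume "smult b p + [:0, 1:] * pderiv p = 0"
    then have "coeff (smult b p + [:0, 1:] * pderiv p) 0 = 0" by (simp only: coeff_0)
    then show False using c0 assms(2) by simp
  qed
  ultimately show ?thesis unfolding pos_rooted_def by simp
qed

lemma coeff_euler_op:
  fixes p :: "real poly"
  shows "coeff (smult b p + [:0, 1:] * pderiv p) m = (b + real m) * coeff p m"
  by (cases m) (auto simp: coeff_pderiv algebra_simps)

section \<open>Polynomial approximants with only positive roots\<close>
text \<open>Decreasing order will yield the bound \<open>t k \<le> (\<Sum>j. t j) / (k + 1)\<close>, and padding by zeros makes
root lists of different lengths comparable as sequences.\<close>
lemma prod_list_conv_antimono_prod:
  assumes "\<forall>x\<in>set xs. (0::real) \<le> x"
  shows "\<exists>t. (\<forall>k. 0 \<le> t k) \<and> antimono t \<and> (\<forall>k\<ge>length xs. t k = 0) \<and>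
    (\<Prod>x\<leftarrow>xs. g x) = (\<Prod>k<length xs. g (t k) :: real poly)"
proof -
  define ys where "ys = rev (sort xs)"
  define t where "t k = (if k < length xs then ys ! k else 0)" for k
  have len: "length ys = length xs" and set: "set ys = set xs" by (auto simp: ys_def)
  have nth: "ys ! k \<ge> 0" if "k < length xs" for k
    using assms that len set nth_mem[of k ys] by auto
  have t0: "0 \<le> t k" for k using nth by (auto simp: t_def)
  have "antimono t"
  proof (rule antimonoI)
    fix i j :: nat assume "i \<le> j"
    then show "t j \<le> t i"
      using nth[of i] sorted_rev_nth_mono[of ys i j] by (auto simp: t_def len ys_def)
  qed
  moreover have "mset (map g xs) = mset (map g ys)" by (simp add: ys_def)
  then have "(\<Prod>x\<leftarrow>xs. g x) = (\<Prod>x\<leftarrow>ys. g x)"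
    by (metis prod_mset_prod_list)
  then have "(\<Prod>x\<leftarrow>xs. g x) = (\<Prod>k<length xs. g (t k))"
    by (simp add: prod.list_conv_set_nth len t_def atLeast0LessThan)
  ultimately show ?thesis using t0 by (intro exI[of _ t]) (auto simp: t_def)
qed

text \<open>The operators \<open>p \<mapsto> (a + j) p + x p'\<close> act diagonally on monomials. Their product multiplies the
coefficient of \<open>x ^ m\<close> by \<open>pochhammer (a + m) j\<close>, which for large \<open>j\<close> is, up to a factor \<open>j ^ m\<close>
and a factor free of \<open>m\<close>, asymptotic to \<open>1 / pochhammer a m\<close>.\<close>
primrec euler_iter :: "real \<Rightarrow> nat \<Rightarrow> real poly \<Rightarrow> real poly" where
  "euler_iter a 0 p = p"
| "euler_iter a (Suc j) p =
     smult (a + real j) (euler_iter a j p) + [:0, 1:] * pderiv (euler_iter a j p)"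

lemma coeff_euler_iter:
  "coeff (euler_iter a j p) m = pochhammer (a + real m) j * coeff p m"
proof (induction j)
  case (Suc j)
  show ?case
    unfolding euler_iter.simps coeff_euler_op Suc.IH by (simp add: pochhammer_Suc algebra_simps)
qed simp

lemma pos_rooted_euler_iter:
  assumes "pos_rooted p" "0 < a"
  shows "pos_rooted (euler_iter a j p)"
  using assms by (induction j) (auto intro!: pos_rooted_euler_op simp del: mult_pCons_left)

lemma pos_rooted_power: "pos_rooted ([:1, -1:] ^ N)"
proof -
  have "map_poly complex_of_real ([:1, -1:] ^ N) = [:1, -1:] ^ N"
  proof (induction N)
    case (Suc N)
    then show ?case
      unfolding power_Suc map_poly_of_real by (simp add: map_poly_pCons del: mult_pCons_left)
  qed simp
  then show ?thesis by (simp add: pos_rooted_def poly_power)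
qed

text \<open>The coefficients of the terminating hypergeometric (Jacobi) polynomial
\<open>\<^sub>2F\<^sub>1(-N, a + N; a; y / N\<^sup>2)\<close>. With \<open>N\<close> tending to infinity the factor \<open>N choose m\<close> absorbs
\<open>N ^ m\<close> into \<open>1 / fact m\<close> and \<open>pochhammer (a + N) m\<close> absorbs the other \<open>N ^ m\<close>.\<close>
definition approx_coeff :: "real \<Rightarrow> nat \<Rightarrow> nat \<Rightarrow> real" where
  "approx_coeff a N m = (-1) ^ m * real (N choose m) * pochhammer (a + real N) m
      / (pochhammer a m * real N ^ (2 * m))"

text \<open>The polynomial arises from \<open>(1 - x) ^ N\<close> by \<open>N\<close> of the Euler operators, so its roots are positive.\<close>
lemma approx_factor:
  assumes "0 < a"
  shows "\<exists>t. (\<forall>k. 0 \<le> t k) \<and> antimono t \<and> (\<forall>k\<ge>N. t k = 0) \<and>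
    (\<forall>m. coeff (\<Prod>k<N. [:1, - t k:]) m = approx_coeff a N m)"
proof -
  define q where "q = euler_iter a N ([:1, -1:] ^ N)"
  have cq: "coeff q m = (-1) ^ m * real (N choose m) * pochhammer (a + real m) N" for m
    by (cases "m \<le> N")
      (simp_all add: q_def coeff_euler_iter coeff_linear_poly_power binomial_eq_0 degree_linear_power coeff_eq_0)
  have pp: "pochhammer (a + x) m > 0" if "x \<ge> 0" for x m
    using assms that by (intro pochhammer_pos) auto
  have shift: "pochhammer (a + real m) N / pochhammer a N = pochhammer (a + real N) m / pochhammer a m" for m
  proof -
    have "pochhammer a m * pochhammer (a + real m) N = pochhammer a N * pochhammer (a + real N) m"
      by (metis pochhammer_product' add.commute)
    then show ?thesis using pp[of 0] by (simp add: field_simps less_imp_neq[symmetric])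
  qed
  have q0: "coeff q 0 = pochhammer a N" by (simp add: cq)
  have q0': "coeff q 0 \<noteq> 0" using pp[of 0 N] by (simp add: q0)
  have "pos_rooted q" unfolding q_def
    by (intro pos_rooted_euler_iter pos_rooted_power assms)
  then obtain ss where ss: "\<forall>s\<in>set ss. 0 < s" "length ss = degree q"
      "q = smult (coeff q 0) (\<Prod>s\<leftarrow>ss. [:1, - s:])"
    using pos_rooted_factor by blast
  have "coeff q N \<noteq> 0" using pp[of "real N" N] by (simp add: cq)
  moreover have "coeff q m = 0" if "m > N" for m using that by (simp add: cq)
  ultimately have deg: "degree q = N"
    by (metis le_degree degree_le le_antisym)
  define xs where "xs = map (\<lambda>s. s / real N ^ 2) ss"
  have xs0: "\<forall>x\<in>set xs. 0 \<le> x" using ss(1) by (auto simp: xs_def intro: less_imp_le)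
  have lxs: "length xs = N" using ss deg by (simp add: xs_def)
  obtain t where t: "\<forall>k. 0 \<le> t k" "antimono t" "\<forall>k\<ge>N. t k = 0"
      "(\<Prod>x\<leftarrow>xs. [:1, - x:]) = (\<Prod>k<N. [:1, - t k:])"
    using prod_list_conv_antimono_prod[OF xs0, of "\<lambda>x. [:1, - x:]"] lxs by auto
  define l :: "real poly" where "l = [:0, 1 / real N ^ 2:]"
  have "pcompose (\<Prod>s\<leftarrow>ss'. [:1, - s:]) l = (\<Prod>x\<leftarrow>map (\<lambda>s. s / real N ^ 2) ss'. [:1, - x:])" for ss'
    by (induction ss') (simp_all add: pcompose_mult pcompose_pCons pcompose_1 l_def del: mult_pCons_left)
  then have comp: "pcompose q l = smult (coeff q 0) (\<Prod>k<N. [:1, - t k:])"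
    by (subst ss(3)) (simp add: pcompose_smult t(4)[symmetric] xs_def)
  have "coeff (\<Prod>k<N. [:1, - t k:]) m = approx_coeff a N m" for m
  proof -
    have "coeff q 0 * coeff (\<Prod>k<N. [:1, - t k:]) m = coeff (pcompose q l) m"
      by (simp add: comp)
    also have "\<dots> = (1 / real N ^ 2) ^ m * coeff q m"
      unfolding l_def by (rule coeff_pcompose_linear)
    finally have "coeff (\<Prod>k<N. [:1, - t k:]) m = (1 / real N ^ 2) ^ m * coeff q m / coeff q 0"
      using q0' by (metis nonzero_mult_div_cancel_left)
    also have "\<dots> = (-1) ^ m * real (N choose m) *
        (pochhammer (a + real m) N / pochhammer a N) / real N ^ (2 * m)"
      by (simp add: cq power_divide power_mult)
    also have "\<dots> = approx_coeff a N m"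
      unfolding shift by (simp add: approx_coeff_def)
    finally show ?thesis .
  qed
  with t show ?thesis by blast
qed

lemma binomial_div_power_le: "real (N choose m) / real N ^ m \<le> 1 / fact m"
proof (cases "m \<le> N")
  case True
  have "real (N choose m) * fact m \<le> real N ^ m"
    using binomial_fact_pow[of N m] by (metis of_nat_fact of_nat_le_iff of_nat_mult of_nat_power)
  moreover have "real N ^ m > 0 \<or> m = 0" using True by auto
  ultimately show ?thesis by (auto simp: field_simps)
qed (simp add: binomial_eq_0)

text \<open>A bound independent of \<open>N\<close>, for dominated convergence of the power series.\<close>
lemma abs_approx_coeff_le:
  assumes "0 < a"
  shows "\<bar>approx_coeff a N m\<bar> \<le> pochhammer (a + 1) m / (fact m * pochhammer a m)"
proof (cases "N = 0")
  case True
  then show ?thesis using assms pochhammer_pos[of a m] pochhammer_pos[of "a+1" m]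
    by (cases m) (auto simp: approx_coeff_def)
next
  case False
  have pa: "pochhammer a m > 0" using assms by (intro pochhammer_pos)
  have pN: "pochhammer (a + real N) m \<ge> 0"
    using assms by (intro less_imp_le pochhammer_pos) auto
  have "pochhammer (a + real N) m \<le> real N ^ m * pochhammer (a + 1) m"
  proof (induction m)
    case (Suc m)
    have "a + real N + real m \<le> real N * (a + 1 + real m)"
    proof -
      have "1 * (a + real m) \<le> real N * (a + real m)"
        using False assms by (intro mult_right_mono) auto
      then show ?thesis by (simp add: algebra_simps)
    qed
    then have "pochhammer (a + real N) m * (a + real N + real m)
        \<le> (real N ^ m * pochhammer (a + 1) m) * (real N * (a + 1 + real m))"
      using Suc assms by (intro mult_mono mult_nonneg_nonneg pochhammer_nonneg) auto
    then show ?case by (simp add: pochhammer_Suc mult_ac)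
  qed simp
  then have le: "pochhammer (a + real N) m / real N ^ m \<le> pochhammer (a + 1) m"
    using False by (simp add: field_simps)
  have "\<bar>approx_coeff a N m\<bar> = (real (N choose m) / real N ^ m) *
      (pochhammer (a + real N) m / real N ^ m) / pochhammer a m"
    using pa pN by (simp add: approx_coeff_def abs_mult power_mult power2_eq_square power_mult_distrib)
  also have "\<dots> \<le> (1 / fact m) * pochhammer (a + 1) m / pochhammer a m"
    using pa pN le binomial_div_power_le assms
    by (intro divide_right_mono mult_mono) auto
  finally show ?thesis by simp
qed

lemma approx_coeff_tendsto:
  assumes "0 < a"
  shows "(\<lambda>N. approx_coeff a N m) \<longlonglongrightarrow> (-1) ^ m / (fact m * pochhammer a m)"
proof -
  have binom: "(\<lambda>N. real (N choose m) / real N ^ m) \<longlonglongrightarrow> 1 / fact m"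
  proof -
    have "(\<lambda>N. (\<Prod>i=0..<m. real N - real i) / real N ^ m) \<longlonglongrightarrow> 1"
    proof (induction m)
      case (Suc m)
      have "(\<lambda>N. 1 - real m / real N) \<longlonglongrightarrow> 1 - 0"
        by (intro tendsto_intros lim_const_over_n)
      moreover have "\<forall>\<^sub>F N in sequentially. 1 - real m / real N = (real N - real m) / real N"
        using eventually_gt_at_top[of 0] by eventually_elim (simp add: field_simps)
      ultimately have "(\<lambda>N. (real N - real m) / real N) \<longlonglongrightarrow> 1"
        by (simp add: filterlim_cong)
      from tendsto_mult[OF Suc this] show ?case by (simp add: mult_ac)
    qed simp
    then have "(\<lambda>N. (\<Prod>i=0..<m. real N - real i) / real N ^ m / fact m) \<longlonglongrightarrow> 1 / fact m"
      by (intro tendsto_intros) auto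
    then show ?thesis by (simp add: binomial_gbinomial gbinomial_prod_rev field_simps)
  qed
  have poch: "(\<lambda>N. pochhammer (a + real N) m / real N ^ m) \<longlonglongrightarrow> 1"
  proof (induction m)
    case (Suc m)
    have "(\<lambda>N. (a + real m) / real N + 1) \<longlonglongrightarrow> 0 + 1"
      by (intro tendsto_intros lim_const_over_n)
    moreover have "\<forall>\<^sub>F N in sequentially. (a + real m) / real N + 1 = (a + real N + real m) / real N"
      using eventually_gt_at_top[of 0] by eventually_elim (simp add: field_simps)
    ultimately have "(\<lambda>N. (a + real N + real m) / real N) \<longlonglongrightarrow> 1"
      by (simp add: filterlim_cong)
    from tendsto_mult[OF Suc this] show ?case by (simp add: pochhammer_Suc mult_ac)
  qed simp
  have "(\<lambda>N. (-1) ^ m * ((real (N choose m) / real N ^ m) *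
       (pochhammer (a + real N) m / real N ^ m)) / pochhammer a m) \<longlonglongrightarrow> (-1) ^ m * (1 / fact m * 1) / pochhammer a m"
    using pochhammer_pos[OF assms, of m]
    by (intro tendsto_divide tendsto_const tendsto_mult[OF tendsto_const tendsto_mult[OF binom poch]]) auto
  then show ?thesis
    by (simp add: approx_coeff_def power_mult power2_eq_square power_mult_distrib mult_ac)
qed

section \<open>Partial fractions for limits of polynomials with positive roots\<close>
lemma poly_tendsto_powser:
  fixes p :: "nat \<Rightarrow> real poly"
  assumes bound: "\<And>N m. \<bar>coeff (p N) m\<bar> \<le> A m"
    and lim: "\<And>m. (\<lambda>N. coeff (p N) m) \<longlonglongrightarrow> c m"
    and sm: "\<And>y. summable (\<lambda>m. A m * y ^ m)"
  shows "(\<lambda>N. poly (p N) y) \<longlonglongrightarrow> (\<Sum>m. c m * y ^ m)"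
proof -
  have "poly (p N) y = (\<Sum>m. coeff (p N) m * y ^ m)" for N
    unfolding poly_altdef
    by (intro suminf_finite[symmetric]) (auto simp: coeff_eq_0 not_le)
  moreover have "(\<lambda>N. \<Sum>m. coeff (p N) m * y ^ m) \<longlonglongrightarrow> (\<Sum>m. c m * y ^ m)"
  proof (rule tannerys_theorem[THEN conjunct2, THEN conjunct2])
    show "((\<lambda>N. coeff (p N) m * y ^ m) \<longlonglongrightarrow> c m * y ^ m)" for m
      by (intro tendsto_intros lim)
    show "\<forall>\<^sub>F (m, N) in at_top \<times>\<^sub>F sequentially. norm (coeff (p N) m * y ^ m) \<le> A m * \<bar>y\<bar> ^ m"
      by (intro always_eventually) (auto simp: abs_mult power_abs intro!: mult_right_mono bound)
    show "summable (\<lambda>m. A m * \<bar>y\<bar> ^ m)" by (rule sm)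
  qed auto
  ultimately show ?thesis by simp
qed

lemma coeff_pderiv_bound:
  fixes p :: "real poly"
  assumes "\<And>m. \<bar>coeff p m\<bar> \<le> A m"
  shows "\<bar>coeff (pderiv p) m\<bar> \<le> diffs A m"
proof -
  have "\<bar>coeff (pderiv p) m\<bar> = (1 + real m) * \<bar>coeff p (Suc m)\<bar>"
    by (simp add: coeff_pderiv abs_mult)
  also have "\<dots> \<le> (1 + real m) * A (Suc m)" using assms by (intro mult_left_mono) auto
  finally show ?thesis by (simp add: diffs_def add.commute)
qed

lemma coeff_pderiv_tendsto:
  fixes p :: "nat \<Rightarrow> real poly"
  assumes "\<And>m. (\<lambda>N. coeff (p N) m) \<longlonglongrightarrow> c m"
  shows "(\<lambda>N. coeff (pderiv (p N)) m) \<longlonglongrightarrow> diffs c m"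
  unfolding coeff_pderiv diffs_def by (intro tendsto_intros) (simp_all add: assms)

lemma coeff_prod_linear:
  fixes t :: "nat \<Rightarrow> real"
  shows "coeff (\<Prod>k<n. [:1, - t k:]) 0 = 1 \<and> coeff (\<Prod>k<n. [:1, - t k:]) 1 = - (\<Sum>k<n. t k)"
  by (induction n) (auto simp: coeff_0_power coeff_mult)

text \<open>The second identity is the derivative of the logarithmic derivative, with denominators cleared so
that it can be passed to a limit without differentiating the limit.\<close>
lemma poly_log_deriv:
  fixes t :: "nat \<Rightarrow> real" and n :: nat
  defines "P \<equiv> (\<Prod>k<n. [:1, - t k:])"
  assumes nz: "\<And>k. k < n \<Longrightarrow> 1 - t k * y \<noteq> 0"
  shows "poly (pderiv P) y = - poly P y * (\<Sum>k<n. t k / (1 - t k * y))" (is ?A)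
    and "(poly (pderiv P) y)\<^sup>2 - poly P y * poly (pderiv (pderiv P)) y
           = (poly P y)\<^sup>2 * (\<Sum>k<n. (t k / (1 - t k * y))\<^sup>2)" (is ?B)
proof -
  have "?A \<and> ?B" unfolding P_def using nz
  proof (induction n)
    case (Suc n)
    define Q where "Q = (\<Prod>k<n. [:1, - t k:])"
    define q q1 q2 where "q = poly Q y" and "q1 = poly (pderiv Q) y" and "q2 = poly (pderiv (pderiv Q)) y"
    define S1 S2 where "S1 = (\<Sum>k<n. t k / (1 - t k * y))" and "S2 = (\<Sum>k<n. (t k / (1 - t k * y))\<^sup>2)"
    define w where "w = 1 - t n * y"
    have w: "w \<noteq> 0" using Suc.prems[of n] by (simp add: w_def)
    have IH: "q1 = - q * S1" "q1\<^sup>2 - q * q2 = q\<^sup>2 * S2"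
      using Suc by (auto simp: q_def q1_def q2_def S1_def S2_def Q_def)
    have PQ: "(\<Prod>k<Suc n. [:1, - t k:]) = [:1, - t n:] * Q"
      by (simp add: Q_def mult.commute del: mult_pCons_left)
    have d0: "poly ([:1, - t n:] * Q) y = w * q"
      by (simp add: w_def q_def algebra_simps)
    have d1: "poly (pderiv ([:1, - t n:] * Q)) y = w * q1 - t n * q"
      unfolding pderiv_mult by (simp add: pderiv_pCons w_def q_def q1_def algebra_simps del: mult_pCons_left)
    have d2: "poly (pderiv (pderiv ([:1, - t n:] * Q))) y = w * q2 - 2 * t n * q1"
      unfolding pderiv_mult pderiv_add
      by (simp add: pderiv_pCons pderiv_mult pderiv_add w_def q_def q1_def q2_def algebra_simps del: mult_pCons_left)
    have s1: "(\<Sum>k<Suc n. t k / (1 - t k * y)) = S1 + t n / w"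
      and s2: "(\<Sum>k<Suc n. (t k / (1 - t k * y))\<^sup>2) = S2 + (t n / w)\<^sup>2"
      by (auto simp: S1_def S2_def w_def)
    show ?case unfolding PQ d0 d1 d2 s1 s2
    proof
      show "w * q1 - t n * q = - (w * q) * (S1 + t n / w)"
        unfolding IH using w by (simp add: field_simps)
      have "(w * q1 - t n * q)\<^sup>2 - w * q * (w * q2 - 2 * t n * q1)
          = w\<^sup>2 * (q1\<^sup>2 - q * q2) + (t n * q)\<^sup>2"
        by (simp add: power2_eq_square algebra_simps)
      also have "\<dots> = (w * q)\<^sup>2 * (S2 + (t n / w)\<^sup>2)"
        unfolding IH(2) using w by (simp add: field_simps)
      finally show "(w * q1 - t n * q)\<^sup>2 - w * q * (w * q2 - 2 * t n * q1)
          = (w * q)\<^sup>2 * (S2 + (t n / w)\<^sup>2)" .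
    qed
  qed simp
  then show ?A ?B by auto
qed

lemma abs_prod_le_exp:
  fixes t :: "nat \<Rightarrow> real"
  assumes "finite K" "\<And>k. k \<in> K \<Longrightarrow> 0 \<le> t k" "sum t K \<le> \<sigma>"
  shows "(\<Prod>k\<in>K. \<bar>1 - t k * y\<bar>) \<le> exp (\<sigma> * \<bar>y\<bar>)"
proof -
  have "(\<Prod>k\<in>K. \<bar>1 - t k * y\<bar>) \<le> (\<Prod>k\<in>K. exp (t k * \<bar>y\<bar>))"
  proof (intro prod_mono conjI)
    fix k assume "k \<in> K"
    have "\<bar>1 - t k * y\<bar> \<le> 1 + t k * \<bar>y\<bar>"
      using abs_triangle_ineq4[of 1 "t k * y"] assms(2)[OF \<open>k \<in> K\<close>] by (simp add: abs_mult)
    also have "\<dots> \<le> exp (t k * \<bar>y\<bar>)" by (rule exp_ge_add_one_self)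
    finally show "\<bar>1 - t k * y\<bar> \<le> exp (t k * \<bar>y\<bar>)" .
  qed auto
  also have "\<dots> = exp (sum t K * \<bar>y\<bar>)"
    using assms(1) by (simp add: exp_sum sum_distrib_right)
  also have "\<dots> \<le> exp (\<sigma> * \<bar>y\<bar>)" using assms(3) by (simp add: mult_right_mono)
  finally show ?thesis .
qed

lemma bounded_seqs_subseq_convergent:
  fixes s :: "nat \<Rightarrow> nat \<Rightarrow> real"
  assumes "\<And>N k. s N k \<in> {0..B}"
  shows "\<exists>t r. strict_mono r \<and> (\<forall>k. (\<lambda>j. s (r j) k) \<longlonglongrightarrow> t k)"
proof -
  have "compact (PiE UNIV (\<lambda>k::nat. {0..B}))"
    using compactin_PiE[of "\<lambda>_::nat. euclidean :: real topology" UNIV "\<lambda>_. {0..B}"]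
    by (simp add: euclidean_product_topology)
  then have "seq_compact (PiE UNIV (\<lambda>k::nat. {0..B}))"
    by (simp add: compact_eq_seq_compact_metric)
  moreover have "\<forall>N. s N \<in> PiE UNIV (\<lambda>k::nat. {0..B})" using assms by auto
  ultimately obtain t r where tr: "strict_mono r" "(s \<circ> r) \<longlonglongrightarrow> t"
    unfolding seq_compact_def by blast
  have "(\<lambda>j. s (r j) k) \<longlonglongrightarrow> t k" for k
  proof -
    have "isCont (\<lambda>f::nat \<Rightarrow> real. f k) t"
      using continuous_on_product_coordinates[of k] continuous_on_eq_continuous_at[OF open_UNIV] by blast
    from isCont_tendsto_compose[OF this tr(2)] show ?thesis by (simp add: o_def)
  qed
  with tr show ?thesis by blast
qed

lemma summable_inverse_square: "summable (\<lambda>k. C / (real k + 1)\<^sup>2)"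
proof -
  have "summable (\<lambda>k. 1 / (real (Suc k))\<^sup>2)"
    using inverse_power_summable[of 2, where 'a=real] summable_Suc_iff[of "\<lambda>k. inverse ((real k)\<^sup>2)"]
    by (simp add: field_simps)
  from summable_mult[OF this, of C] show ?thesis by (simp add: add.commute)
qed

text \<open>An entire function with Taylor coefficients \<open>c\<close> as the locally uniform limit of polynomials whose
roots are \<open>1 / s N k\<close>, with \<open>s N k = 0\<close> for a root that is absent.\<close>
locale hyperbolic_limit =
  fixes s :: "nat \<Rightarrow> nat \<Rightarrow> real" and A c :: "nat \<Rightarrow> real"
  assumes s_nonneg: "0 \<le> s N k"
    and s_antimono: "antimono (s N)"
    and s_zero: "N \<le> k \<Longrightarrow> s N k = 0"
    and coeff_bound: "\<bar>coeff (\<Prod>k<N. [:1, - s N k:]) m\<bar> \<le> A m"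
    and coeff_lim: "(\<lambda>N. coeff (\<Prod>k<N. [:1, - s N k:]) m) \<longlonglongrightarrow> c m"
    and A_summable: "summable (\<lambda>m. A m * y ^ m)"
begin

abbreviation "p N \<equiv> (\<Prod>k<N. [:1, - s N k:])"

definition "h y = (\<Sum>m. c m * y ^ m)"
definition "h1 y = (\<Sum>m. diffs c m * y ^ m)"
definition "h2 y = (\<Sum>m. diffs (diffs c) m * y ^ m)"

lemma summable_diffs: "summable (\<lambda>m. diffs A m * y ^ m)" "summable (\<lambda>m. diffs (diffs A) m * y ^ m)"
  by (intro termdiff_converges_all A_summable)+

lemma poly_lim:
  "(\<lambda>N. poly (p N) y) \<longlonglongrightarrow> h y"
  "(\<lambda>N. poly (pderiv (p N)) y) \<longlonglongrightarrow> h1 y"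
  "(\<lambda>N. poly (pderiv (pderiv (p N))) y) \<longlonglongrightarrow> h2 y"
  unfolding h_def h1_def h2_def
  by (rule poly_tendsto_powser coeff_pderiv_bound coeff_bound coeff_pderiv_tendsto coeff_lim
      A_summable summable_diffs)+

lemma s_nonzeroD: "s N k \<noteq> 0 \<Longrightarrow> k < N"
  by (meson not_le s_zero)

lemma sum_s: "(\<Sum>k<N. s N k) = - coeff (p N) 1"
  using coeff_prod_linear[of "s N" N] by simp

lemma sum_s_le: "(\<Sum>k<N. s N k) \<le> A 1"
  using coeff_bound[of N 1] by (simp add: sum_s)

text \<open>The sum of the reciprocal roots is minus the linear coefficient, hence bounded.\<close>
lemma sum_s_subset_le:
  assumes "finite K"
  shows "(\<Sum>k\<in>K. s N k) \<le> A 1"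
proof -
  have "(\<Sum>k\<in>K. s N k) = (\<Sum>k\<in>K \<inter> {..<N}. s N k)"
    using assms by (intro sum.mono_neutral_right) (auto dest: s_nonzeroD)
  also have "\<dots> \<le> (\<Sum>k<N. s N k)" by (intro sum_mono2) (auto simp: s_nonneg)
  finally show ?thesis using sum_s_le[of N] by linarith
qed

lemma s_le: "s N k \<le> A 1 / (real k + 1)"
proof -
  have "(real k + 1) * s N k = (\<Sum>j\<le>k. s N k)" by (simp add: algebra_simps)
  also have "\<dots> \<le> (\<Sum>j\<le>k. s N j)" using s_antimono by (intro sum_mono) (auto simp: antimono_def)
  also have "\<dots> \<le> A 1" by (rule sum_s_subset_le) auto
  finally show ?thesis by (simp add: field_simps)
qed

text \<open>All factors but one are together at most \<open>exp (A 1 * \<bar>y\<bar>)\<close>, so each single factor is bounded below by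
the value of the polynomial. Where the limit function does not vanish, this keeps all denominators
\<open>1 - s N k * y\<close> away from zero, uniformly in \<open>N\<close> and \<open>k\<close>.\<close>
lemma factor_lower_bound:
  "\<bar>poly (p N) y\<bar> * exp (- A 1 * \<bar>y\<bar>) \<le> \<bar>1 - s N k * y\<bar>"
proof -
  have prod: "\<bar>poly (p N) y\<bar> = (\<Prod>k<N. \<bar>1 - s N k * y\<bar>)"
    by (simp add: poly_prod abs_prod algebra_simps)
  have "\<bar>poly (p N) y\<bar> \<le> \<bar>1 - s N k * y\<bar> * exp (A 1 * \<bar>y\<bar>)"
  proof (cases "k < N")
    case True
    have "\<bar>poly (p N) y\<bar> = \<bar>1 - s N k * y\<bar> * (\<Prod>j\<in>{..<N} - {k}. \<bar>1 - s N j * y\<bar>)"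
      unfolding prod using True by (intro prod.remove) auto
    also have "\<dots> \<le> \<bar>1 - s N k * y\<bar> * exp (A 1 * \<bar>y\<bar>)"
      by (intro mult_left_mono abs_prod_le_exp sum_s_subset_le) (auto simp: s_nonneg)
    finally show ?thesis .
  next
    case False
    then have "\<bar>1 - s N k * y\<bar> = 1" by (simp add: s_zero)
    then show ?thesis unfolding prod
      using abs_prod_le_exp[of "{..<N}" "s N" "A 1" y] sum_s_le[of N] by (simp add: s_nonneg)
  qed
  then have "\<bar>poly (p N) y\<bar> * exp (- A 1 * \<bar>y\<bar>) \<le> \<bar>1 - s N k * y\<bar> * exp (A 1 * \<bar>y\<bar>) * exp (- A 1 * \<bar>y\<bar>)"
    by (intro mult_right_mono) auto
  also have "\<dots> = \<bar>1 - s N k * y\<bar>" by (simp add: mult.assoc flip: exp_add)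
  finally show ?thesis .
qed

text \<open>Along a subsequence all the reciprocal roots converge, and Tannery's theorem applies to every sum
that is quadratic in them, because \<open>s N k \<le> A 1 / (k + 1)\<close>. The sum \<open>\<Sum>k. s N k\<close> itself is only
bounded: mass may escape to infinitely large roots. The constant \<open>d\<close> is the escaped mass; it
corresponds to a factor \<open>exp (- d * y)\<close> in the product representation of \<open>h\<close>.\<close>
theorem partial_fractions:
  "\<exists>t d. (\<forall>k. 0 \<le> t k) \<and> summable t \<and> 0 \<le> d \<and>
     (\<forall>y. h y \<noteq> 0 \<longrightarrow> (\<forall>k. t k * y \<noteq> 1) \<and>
        summable (\<lambda>k. t k / (1 - t k * y)) \<and> summable (\<lambda>k. (t k / (1 - t k * y))\<^sup>2) \<and>
        h1 y = - h y * (d + (\<Sum>k. t k / (1 - t k * y))) \<and>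
        (h1 y)\<^sup>2 - h y * h2 y = (h y)\<^sup>2 * (\<Sum>k. (t k / (1 - t k * y))\<^sup>2))"
proof -
  define \<sigma> where "\<sigma> = A 1"
  have \<sigma>0: "0 \<le> \<sigma>" using sum_s_subset_le[of "{}" 0] by (simp add: \<sigma>_def)
  have "s N k \<in> {0..\<sigma>}" for N k
    using s_nonneg sum_s_subset_le[of "{k}" N] by (auto simp: \<sigma>_def)
  then obtain t r where r: "strict_mono r" and t: "\<And>k. (\<lambda>j. s (r j) k) \<longlonglongrightarrow> t k"
    using bounded_seqs_subseq_convergent[of s \<sigma>] by blast
  have t0: "0 \<le> t k" for k
    using LIMSEQ_le_const[OF t] s_nonneg by blast
  have c1: "(\<lambda>j. \<Sum>k<r j. s (r j) k) \<longlonglongrightarrow> - c 1"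
    unfolding sum_s using LIMSEQ_subseq_LIMSEQ[OF tendsto_minus[OF coeff_lim[of 1]] r] by (simp add: o_def)
  have part: "sum t {..<n} \<le> - c 1" for n
  proof (rule LIMSEQ_le[OF _ c1])
    show "(\<lambda>j. \<Sum>k<n. s (r j) k) \<longlonglongrightarrow> sum t {..<n}" by (intro tendsto_sum t)
    have "(\<Sum>k<n. s (r j) k) \<le> (\<Sum>k<r j. s (r j) k)" for j
    proof -
      have "(\<Sum>k<n. s (r j) k) = (\<Sum>k\<in>{..<n} \<inter> {..<r j}. s (r j) k)"
        by (intro sum.mono_neutral_right) (auto dest: s_nonzeroD)
      also have "\<dots> \<le> (\<Sum>k<r j. s (r j) k)" by (intro sum_mono2) (auto simp: s_nonneg)
      finally show ?thesis .
    qed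
    then show "\<exists>M. \<forall>j\<ge>M. (\<Sum>k<n. s (r j) k) \<le> (\<Sum>k<r j. s (r j) k)" by blast
  qed
  have sumt: "summable t"
    using part t0 by (intro summableI_nonneg_bounded) auto
  define d where "d = - c 1 - suminf t"
  have d0: "0 \<le> d" using suminf_le_const[OF sumt part] by (simp add: d_def)
  have main: "(\<forall>k. t k * y \<noteq> 1) \<and>
        summable (\<lambda>k. t k / (1 - t k * y)) \<and> summable (\<lambda>k. (t k / (1 - t k * y))\<^sup>2) \<and>
        h1 y = - h y * (d + (\<Sum>k. t k / (1 - t k * y))) \<and>
        (h1 y)\<^sup>2 - h y * h2 y = (h y)\<^sup>2 * (\<Sum>k. (t k / (1 - t k * y))\<^sup>2)"
    if hy: "h y \<noteq> 0" for y
  proof -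
    define \<delta> where "\<delta> = \<bar>h y\<bar> / 2 * exp (- \<sigma> * \<bar>y\<bar>)"
    have \<delta>: "0 < \<delta>" using hy by (simp add: \<delta>_def)
    have plim: "(\<lambda>j. poly (p (r j)) y) \<longlonglongrightarrow> h y"
      "(\<lambda>j. poly (pderiv (p (r j))) y) \<longlonglongrightarrow> h1 y"
      "(\<lambda>j. poly (pderiv (pderiv (p (r j)))) y) \<longlonglongrightarrow> h2 y"
      using poly_lim[THEN LIMSEQ_subseq_LIMSEQ, OF r] by (auto simp: o_def)
    have "(\<lambda>j. \<bar>poly (p (r j)) y\<bar>) \<longlonglongrightarrow> \<bar>h y\<bar>" by (intro tendsto_rabs plim)
    then have "\<forall>\<^sub>F j in sequentially. \<bar>h y\<bar> / 2 < \<bar>poly (p (r j)) y\<bar>"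
      by (rule order_tendstoD) (use hy in auto)
    then have lower: "\<forall>\<^sub>F j in sequentially. \<forall>k. \<delta> \<le> \<bar>1 - s (r j) k * y\<bar>"
    proof eventually_elim
      case (elim j)
      have "\<delta> \<le> \<bar>poly (p (r j)) y\<bar> * exp (- \<sigma> * \<bar>y\<bar>)"
        unfolding \<delta>_def using elim by (intro mult_right_mono) auto
      with factor_lower_bound[of "r j" y] show ?case unfolding \<sigma>_def by (meson order_trans)
    qed
    have lowt: "\<delta> \<le> \<bar>1 - t k * y\<bar>" for k
    proof (rule tendsto_lowerbound)
      show "(\<lambda>j. \<bar>1 - s (r j) k * y\<bar>) \<longlonglongrightarrow> \<bar>1 - t k * y\<bar>" by (intro tendsto_intros t)
      show "\<forall>\<^sub>F j in sequentially. \<delta> \<le> \<bar>1 - s (r j) k * y\<bar>"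
        using lower by eventually_elim blast
    qed auto
    then have nz: "1 - t k * y \<noteq> 0" for k using \<delta> by (metis abs_zero not_le)
    have tan: "summable (\<lambda>k. norm (f (t k))) \<and> (\<lambda>j. \<Sum>k<r j. f (s (r j) k)) \<longlonglongrightarrow> (\<Sum>k. f (t k))"
      if f: "f = (\<lambda>x. x\<^sup>2 * g x)" and g: "\<And>x. \<delta> \<le> \<bar>1 - x * y\<bar> \<Longrightarrow> isCont g x \<and> \<bar>g x\<bar> \<le> C" for f g C
    proof -
      have eq: "(\<Sum>k<r j. f (s (r j) k)) = (\<Sum>k. f (s (r j) k))" for j
        by (rule suminf_finite[symmetric]) (auto simp: f s_zero)
      show ?thesis unfolding eq
      proof (rule tannerys_theorem[THEN conjunct2])
        have "isCont f (t k)" for k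
          unfolding f using g[OF lowt] by (intro continuous_intros) auto
        then show "(\<lambda>j. f (s (r j) k)) \<longlonglongrightarrow> f (t k)" for k
          by (rule isCont_tendsto_compose) (rule t)
        show "summable (\<lambda>k. (\<sigma>\<^sup>2 * C) / (real k + 1)\<^sup>2)" by (rule summable_inverse_square)
        have "\<forall>\<^sub>F j in sequentially. \<forall>k. norm (f (s (r j) k)) \<le> (\<sigma>\<^sup>2 * C) / (real k + 1)\<^sup>2"
          using lower
        proof eventually_elim
          case (elim j)
          show ?case
          proof
            fix k
            have "\<bar>g (s (r j) k)\<bar> \<le> C" using g elim by blast
            moreover have "(s (r j) k)\<^sup>2 \<le> (\<sigma> / (real k + 1))\<^sup>2"
              using s_nonneg s_le unfolding \<sigma>_def by (intro power_mono) auto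
            ultimately have "(s (r j) k)\<^sup>2 * \<bar>g (s (r j) k)\<bar> \<le> (\<sigma> / (real k + 1))\<^sup>2 * C"
              by (intro mult_mono) auto
            then show "norm (f (s (r j) k)) \<le> (\<sigma>\<^sup>2 * C) / (real k + 1)\<^sup>2"
              by (simp add: f abs_mult power_divide)
          qed
        qed
        then show "\<forall>\<^sub>F (k, j) in at_top \<times>\<^sub>F sequentially. norm (f (s (r j) k)) \<le> (\<sigma>\<^sup>2 * C) / (real k + 1)\<^sup>2"
          unfolding eventually_prod_filter case_prod_conv
          by (intro exI[of _ "\<lambda>_. True"] exI[of _ "\<lambda>j. \<forall>k. norm (f (s (r j) k)) \<le> (\<sigma>\<^sup>2 * C) / (real k + 1)\<^sup>2"]) auto
      qed auto
    qed
    \<comment> \<open>Removing the linear part \<open>x\<close> from \<open>x / (1 - x * y)\<close> leaves \<open>f1 x\<close>, which is quadratic in \<open>x\<close>.\<close>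
    define f1 f2 :: "real \<Rightarrow> real" where "f1 = (\<lambda>x. x\<^sup>2 * (y / (1 - x * y)))" and "f2 = (\<lambda>x. x\<^sup>2 * (1 / (1 - x * y)\<^sup>2))"
    have T1: "summable (\<lambda>k. norm (f1 (t k))) \<and> (\<lambda>j. \<Sum>k<r j. f1 (s (r j) k)) \<longlonglongrightarrow> (\<Sum>k. f1 (t k))"
    proof (rule tan[OF f1_def, of "\<bar>y\<bar> / \<delta>"])
      fix x assume x: "\<delta> \<le> \<bar>1 - x * y\<bar>"
      then have "1 - x * y \<noteq> 0" using \<delta> by auto
      then show "isCont (\<lambda>x. y / (1 - x * y)) x \<and> \<bar>y / (1 - x * y)\<bar> \<le> \<bar>y\<bar> / \<delta>"
        using x \<delta> by (auto intro!: continuous_intros frac_le)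
    qed
    have T2: "summable (\<lambda>k. norm (f2 (t k))) \<and> (\<lambda>j. \<Sum>k<r j. f2 (s (r j) k)) \<longlonglongrightarrow> (\<Sum>k. f2 (t k))"
    proof (rule tan[OF f2_def, of "1 / \<delta>\<^sup>2"])
      fix x assume x: "\<delta> \<le> \<bar>1 - x * y\<bar>"
      then have "1 - x * y \<noteq> 0" using \<delta> by auto
      moreover have "\<delta>\<^sup>2 \<le> (1 - x * y)\<^sup>2" using x \<delta> by (metis abs_ge_zero less_imp_le power2_abs power_mono)
      ultimately show "isCont (\<lambda>x. 1 / (1 - x * y)\<^sup>2) x \<and> \<bar>1 / (1 - x * y)\<^sup>2\<bar> \<le> 1 / \<delta>\<^sup>2"
        using \<delta> by (auto intro!: continuous_intros frac_le)
    qed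
    have split: "x / (1 - x * y) = x + f1 x" if "1 - x * y \<noteq> 0" for x
    proof -
      have "x + f1 x = (x * (1 - x * y) + x * (x * y)) / (1 - x * y)"
        unfolding f1_def add_divide_distrib using that by (simp add: power2_eq_square)
      also have "x * (1 - x * y) + x * (x * y) = x" by (simp add: algebra_simps)
      finally show ?thesis ..
    qed
    have f2: "(x / (1 - x * y))\<^sup>2 = f2 x" for x by (simp add: f2_def power_divide)
    have sf1: "summable (\<lambda>k. f1 (t k))" by (rule summable_norm_cancel[OF T1[THEN conjunct1]])
    have S1: "summable (\<lambda>k. t k / (1 - t k * y))"
      unfolding split[OF nz] by (rule summable_add[OF sumt sf1])
    have S1eq: "(\<Sum>k. t k / (1 - t k * y)) = suminf t + (\<Sum>k. f1 (t k))"
      unfolding split[OF nz] by (rule suminf_add[OF sumt sf1, symmetric])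
    have S2: "summable (\<lambda>k. (t k / (1 - t k * y))\<^sup>2)"
      unfolding f2 by (rule summable_norm_cancel[OF T2[THEN conjunct1]])
    have nzs: "\<forall>\<^sub>F j in sequentially. \<forall>k. 1 - s (r j) k * y \<noteq> 0"
      using lower
    proof eventually_elim
      case (elim j)
      then show ?case using \<delta> by (metis abs_zero not_le)
    qed
    have "(\<lambda>j. - poly (p (r j)) y * ((\<Sum>k<r j. s (r j) k) + (\<Sum>k<r j. f1 (s (r j) k))))
        \<longlonglongrightarrow> - h y * (- c 1 + (\<Sum>k. f1 (t k)))"
      by (intro tendsto_intros plim c1 T1[THEN conjunct2])
    moreover have "\<forall>\<^sub>F j in sequentially. - poly (p (r j)) y * ((\<Sum>k<r j. s (r j) k) + (\<Sum>k<r j. f1 (s (r j) k)))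
        = poly (pderiv (p (r j))) y"
      using nzs
    proof eventually_elim
      case (elim j)
      then show ?case by (subst poly_log_deriv(1)) (auto simp: split sum.distrib)
    qed
    ultimately have "(\<lambda>j. poly (pderiv (p (r j))) y) \<longlonglongrightarrow> - h y * (- c 1 + (\<Sum>k. f1 (t k)))"
      by (rule Lim_transform_eventually)
    then have "h1 y = - h y * (- c 1 + (\<Sum>k. f1 (t k)))"
      by (rule LIMSEQ_unique[OF plim(2)])
    also have "- c 1 + (\<Sum>k. f1 (t k)) = d + (\<Sum>k. t k / (1 - t k * y))"
      by (simp add: S1eq d_def)
    finally have E1: "h1 y = - h y * (d + (\<Sum>k. t k / (1 - t k * y)))" .
    have "(\<lambda>j. (poly (p (r j)) y)\<^sup>2 * (\<Sum>k<r j. f2 (s (r j) k))) \<longlonglongrightarrow> (h y)\<^sup>2 * (\<Sum>k. f2 (t k))"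
      by (intro tendsto_intros plim T2[THEN conjunct2])
    moreover have "\<forall>\<^sub>F j in sequentially. (poly (p (r j)) y)\<^sup>2 * (\<Sum>k<r j. f2 (s (r j) k))
        = (poly (pderiv (p (r j))) y)\<^sup>2 - poly (p (r j)) y * poly (pderiv (pderiv (p (r j)))) y"
      using nzs
    proof eventually_elim
      case (elim j)
      then show ?case by (subst poly_log_deriv(2)) (auto simp: f2)
    qed
    ultimately have "(\<lambda>j. (poly (pderiv (p (r j))) y)\<^sup>2 - poly (p (r j)) y * poly (pderiv (pderiv (p (r j)))) y)
        \<longlonglongrightarrow> (h y)\<^sup>2 * (\<Sum>k. f2 (t k))"
      by (rule Lim_transform_eventually)
    moreover have "(\<lambda>j. (poly (pderiv (p (r j))) y)\<^sup>2 - poly (p (r j)) y * poly (pderiv (pderiv (p (r j)))) y)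
        \<longlonglongrightarrow> (h1 y)\<^sup>2 - h y * h2 y"
      by (intro tendsto_intros plim)
    ultimately have E2: "(h1 y)\<^sup>2 - h y * h2 y = (h y)\<^sup>2 * (\<Sum>k. (t k / (1 - t k * y))\<^sup>2)"
      unfolding f2 by (rule LIMSEQ_unique[rotated])
    show ?thesis using nz S1 S2 E1 E2 by auto
  qed
  show ?thesis
    by (intro exI[of _ t] exI[of _ d]) (use t0 sumt d0 main in blast)
qed

end

section \<open>The entire function behind the Bessel function\<close>
text \<open>The Bessel--Clifford function, \<open>\<^sub>0F\<^sub>1(; a; -y)\<close>: up to a factor without positive zeros, \<open>J\<^sub>\<mu>(x)\<close> is
its value for \<open>a = \<mu> + 1\<close> and \<open>y = x\<^sup>2 / 4\<close>.\<close>
definition clifford_coeff :: "real \<Rightarrow> nat \<Rightarrow> real" where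
  "clifford_coeff a m = (-1) ^ m / (fact m * pochhammer a m)"

definition clifford :: "real \<Rightarrow> real \<Rightarrow> real" where
  "clifford a y = (\<Sum>m. clifford_coeff a m * y ^ m)"

definition approx_bound :: "real \<Rightarrow> nat \<Rightarrow> real" where
  "approx_bound a m = pochhammer (a + 1) m / (fact m * pochhammer a m)"

lemma approx_bound_summable:
  assumes "0 < a"
  shows "summable (\<lambda>m. approx_bound a m * y ^ m)"
proof (rule summable_comparison_test')
  show "summable (\<lambda>m. (1 + 1 / a) * (inverse (fact m) * (2 * \<bar>y\<bar>) ^ m))"
    by (intro summable_mult summable_exp)
  fix m :: nat assume "0 \<le> m"
  have pa: "pochhammer a m > 0" using assms by (intro pochhammer_pos)
  have "a * pochhammer (a + 1) m = pochhammer a m * (a + real m)"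
    by (metis pochhammer_rec pochhammer_Suc)
  then have "approx_bound a m = (1 + real m / a) / fact m"
    using pa assms by (simp add: approx_bound_def field_simps)
  also have "\<dots> \<le> ((1 + 1 / a) * 2 ^ m) / fact m"
  proof (rule divide_right_mono)
    have "real m \<le> 2 ^ m" using less_exp[of m] by (metis less_imp_le of_nat_less_numeral_power_cancel_iff)
    then have "1 + real m / a \<le> 2 ^ m + 2 ^ m / a"
      using assms by (intro add_mono divide_right_mono) auto
    then show "1 + real m / a \<le> (1 + 1 / a) * 2 ^ m" by (simp add: algebra_simps)
  qed simp
  finally have "approx_bound a m * \<bar>y\<bar> ^ m \<le> ((1 + 1 / a) * 2 ^ m) / fact m * \<bar>y\<bar> ^ m"
    by (rule mult_right_mono) simp
  moreover have "approx_bound a m \<ge> 0"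
    using pa assms by (auto simp: approx_bound_def intro!: divide_nonneg_nonneg pochhammer_nonneg)
  ultimately show "norm (approx_bound a m * y ^ m) \<le> (1 + 1 / a) * (inverse (fact m) * (2 * \<bar>y\<bar>) ^ m)"
    by (simp add: abs_mult power_abs power_mult_distrib field_simps)
qed

lemma clifford_summable:
  assumes "0 < a"
  shows "summable (\<lambda>m. clifford_coeff a m * y ^ m)"
proof (rule summable_comparison_test')
  show "summable (\<lambda>m. approx_bound a m * \<bar>y\<bar> ^ m)" by (rule approx_bound_summable[OF assms])
  fix m :: nat assume "0 \<le> m"
  have "\<bar>clifford_coeff a m\<bar> \<le> approx_bound a m"
    unfolding clifford_coeff_def approx_bound_def
    using approx_coeff_tendsto[OF assms, of m] abs_approx_coeff_le[OF assms]
    by (intro LIMSEQ_le_const2[OF tendsto_rabs]) auto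
  then show "norm (clifford_coeff a m * y ^ m) \<le> approx_bound a m * \<bar>y\<bar> ^ m"
    by (simp add: abs_mult power_abs mult_right_mono)
qed

lemma diffs_clifford_coeff:
  assumes "0 < a"
  shows "diffs (clifford_coeff a) m = - 1 / a * clifford_coeff (a + 1) m"
  using assms pochhammer_pos[of "a + 1" m]
  by (simp add: diffs_def clifford_coeff_def pochhammer_rec divide_simps)

lemma diffs_clifford_series:
  assumes "0 < a"
  shows "(\<Sum>m. diffs (clifford_coeff a) m * y ^ m) = - clifford (a + 1) y / a"
  using assms suminf_mult[OF clifford_summable[of "a + 1" y], of "- 1 / a"]
  by (simp add: diffs_clifford_coeff clifford_def mult_ac)

lemma diffs2_clifford_series:
  assumes "0 < a"
  shows "(\<Sum>m. diffs (diffs (clifford_coeff a)) m * y ^ m) = clifford (a + 2) y / (a * (a + 1))"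
proof -
  have "diffs (diffs (clifford_coeff a)) m = 1 / (a * (a + 1)) * clifford_coeff (a + 2) m" for m
  proof -
    have "diffs (diffs (clifford_coeff a)) m = - 1 / a * diffs (clifford_coeff (a + 1)) m"
      by (simp add: diffs_def[of "diffs (clifford_coeff a)"] diffs_clifford_coeff[OF assms])
        (simp add: diffs_def)
    then show ?thesis using assms by (simp add: diffs_clifford_coeff add.assoc)
  qed
  then show ?thesis
    using assms suminf_mult[OF clifford_summable[of "a + 2" y], of "1 / (a * (a + 1))"]
    by (simp add: clifford_def mult.assoc)
qed

lemma clifford_has_derivative:
  assumes "0 < a"
  shows "(clifford a has_real_derivative - clifford (a + 1) y / a) (at y)"
  using termdiffs_strong_converges_everywhere[of "clifford_coeff a" y] clifford_summable[OF assms]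
  by (simp add: diffs_clifford_series[OF assms] clifford_def[abs_def])

lemma isCont_clifford: "0 < a \<Longrightarrow> isCont (clifford a) y"
  using clifford_has_derivative DERIV_isCont by blast

text \<open>Since differentiation shifts \<open>a\<close>, this contiguous relation is the differential equation
\<open>y h'' + a h' + h = 0\<close> of \<open>h = clifford a\<close>.\<close>
lemma clifford_recurrence:
  assumes "0 < a"
  shows "y * (clifford (a + 2) y / (a * (a + 1))) = clifford (a + 1) y - clifford a y"
proof -
  have sm: "summable (\<lambda>m. clifford_coeff (a + 1) m * y ^ m - clifford_coeff a m * y ^ m)"
    using assms by (intro summable_diff clifford_summable) auto
  have "clifford (a + 1) y - clifford a y
      = (\<Sum>m. clifford_coeff (a + 1) m * y ^ m - clifford_coeff a m * y ^ m)"
    unfolding clifford_def using assms by (intro suminf_diff clifford_summable) auto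
  also have "\<dots> = (\<Sum>m. clifford_coeff (a + 1) (Suc m) * y ^ Suc m - clifford_coeff a (Suc m) * y ^ Suc m)"
    using suminf_split_head[OF sm] by (simp add: clifford_coeff_def)
  also have "\<dots> = (\<Sum>m. y / (a * (a + 1)) * (clifford_coeff (a + 2) m * y ^ m))"
  proof (rule suminf_cong)
    fix m
    define P where "P = pochhammer (a + 2) m"
    have P: "P > 0" using assms by (auto simp: P_def intro: pochhammer_pos)
    have p1: "pochhammer (a + 1) (Suc m) = (a + 1) * P"
      by (simp add: pochhammer_rec P_def add.assoc)
    have p2: "pochhammer (a + 1) m * (a + 1 + real m) = (a + 1) * P"
      using p1 by (simp add: pochhammer_Suc)
    have p3: "pochhammer a (Suc m) = a * (a + 1) * P / (a + 1 + real m)"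
      using p2 assms by (simp add: pochhammer_rec field_simps)
    have "clifford_coeff (a + 1) (Suc m) - clifford_coeff a (Suc m) =
        (-1) ^ Suc m / fact (Suc m) * (1 / ((a + 1) * P) - (a + 1 + real m) / (a * (a + 1) * P))"
      unfolding clifford_coeff_def p1 p3 by (simp add: right_diff_distrib)
    also have "1 / ((a + 1) * P) - (a + 1 + real m) / (a * (a + 1) * P)
        = - real (Suc m) / (a * (a + 1) * P)"
      using assms P by (simp add: divide_simps)
    also have "(-1) ^ Suc m / fact (Suc m) * (- real (Suc m) / (a * (a + 1) * P))
        = (-1) ^ m * (real (Suc m) / fact (Suc m)) / (a * (a + 1) * P)"
      unfolding power_Suc by (simp del: fact_Suc of_nat_Suc)
    also have "real (Suc m) / fact (Suc m) = 1 / fact m" by (simp del: of_nat_Suc)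
    also have "(-1) ^ m * (1 / fact m) / (a * (a + 1) * P) = 1 / (a * (a + 1)) * clifford_coeff (a + 2) m"
      by (simp add: clifford_coeff_def P_def)
    finally have "clifford_coeff (a + 1) (Suc m) - clifford_coeff a (Suc m)
        = 1 / (a * (a + 1)) * clifford_coeff (a + 2) m" .
    then show "clifford_coeff (a + 1) (Suc m) * y ^ Suc m - clifford_coeff a (Suc m) * y ^ Suc m
        = y / (a * (a + 1)) * (clifford_coeff (a + 2) m * y ^ m)"
      by (simp only: left_diff_distrib[symmetric]) simp
  qed
  also have "\<dots> = y / (a * (a + 1)) * clifford (a + 2) y"
    unfolding clifford_def using assms by (intro suminf_mult clifford_summable) auto
  finally show ?thesis by simp
qed

lemma clifford_pos_nonpos_arg:
  assumes "0 < a" "y \<le> 0"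
  shows "0 < clifford a y"
proof -
  have "0 \<le> clifford_coeff a m * y ^ m" for m
  proof -
    have "clifford_coeff a m * y ^ m = (- y) ^ m / (fact m * pochhammer a m)"
      by (simp add: clifford_coeff_def power_minus[of y])
    then show ?thesis using assms by (auto intro!: divide_nonneg_nonneg mult_nonneg_nonneg pochhammer_nonneg)
  qed
  then have "(\<Sum>m<1. clifford_coeff a m * y ^ m) \<le> clifford a y"
    unfolding clifford_def by (intro sum_le_suminf clifford_summable assms) auto
  then show ?thesis by (simp add: clifford_coeff_def)
qed

lemma clifford_near_one:
  assumes "1 \<le> b"
  shows "\<bar>clifford b y - 1\<bar> \<le> exp \<bar>y\<bar> / b"
proof -
  have b: "0 < b" using assms by simp
  have sm: "summable (\<lambda>m. clifford_coeff b (Suc m) * y ^ Suc m)"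
    using clifford_summable[OF b, of y] by (subst summable_Suc_iff)
  have e: "summable (\<lambda>m. inverse (fact m) * \<bar>y\<bar> ^ m)" by (rule summable_exp)
  have e': "summable (\<lambda>m. inverse (fact (Suc m)) * \<bar>y\<bar> ^ Suc m / b)"
    using e by (intro summable_divide) (subst summable_Suc_iff)
  have le: "norm (clifford_coeff b (Suc m) * y ^ Suc m) \<le> inverse (fact (Suc m)) * \<bar>y\<bar> ^ Suc m / b" for m
  proof -
    have "1 \<le> pochhammer (b + 1) m"
    proof (induction m)
      case (Suc m)
      have "1 * 1 \<le> pochhammer (b + 1) m * (b + 1 + real m)"
        using Suc assms by (intro mult_mono) auto
      then show ?case by (simp add: pochhammer_Suc)
    qed simp
    then have "b * 1 \<le> pochhammer b (Suc m)"
      unfolding pochhammer_rec using b by (intro mult_left_mono) auto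
    then have "b \<le> pochhammer b (Suc m)" by simp
    then have "norm (clifford_coeff b (Suc m)) \<le> 1 / (fact (Suc m) * b)"
      unfolding clifford_coeff_def using b
      by (auto simp: abs_mult power_abs intro!: divide_left_mono mult_left_mono mult_pos_pos simp del: fact_Suc)
    then have "norm (clifford_coeff b (Suc m)) * \<bar>y\<bar> ^ Suc m \<le> 1 / (fact (Suc m) * b) * \<bar>y\<bar> ^ Suc m"
      by (rule mult_right_mono) simp
    then show ?thesis by (simp add: norm_mult power_abs divide_inverse mult_ac abs_mult del: fact_Suc)
  qed
  have "clifford b y - 1 = (\<Sum>m. clifford_coeff b (Suc m) * y ^ Suc m)"
    using suminf_split_head[OF clifford_summable[OF b, of y]] by (simp add: clifford_def clifford_coeff_def)
  also have "norm \<dots> \<le> (\<Sum>m. inverse (fact (Suc m)) * \<bar>y\<bar> ^ Suc m / b)"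
  proof -
    have "summable (\<lambda>m. norm (clifford_coeff b (Suc m) * y ^ Suc m))"
      by (rule summable_comparison_test'[OF e', of 0]) (use le in auto)
    then show ?thesis by (intro order_trans[OF summable_norm suminf_le[OF le _ e']])
  qed
  also have "\<dots> = ((\<Sum>m. inverse (fact m) * \<bar>y\<bar> ^ m) - 1) / b"
    using suminf_split_head[OF e] suminf_divide[of "\<lambda>m. inverse (fact (Suc m)) * \<bar>y\<bar> ^ Suc m" b] e
    by (simp add: summable_Suc_iff[of "\<lambda>m. inverse (fact m) * \<bar>y\<bar> ^ m"] del: fact_Suc power_Suc)
  also have "\<dots> \<le> exp \<bar>y\<bar> / b"
    using b by (simp add: exp_def divide_inverse mult.commute mult_right_mono)
  finally show ?thesis by simp
qed

text \<open>By the recurrence a common zero would be shared by \<open>clifford (a + n)\<close> for all \<open>n\<close>, but these tend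
to \<open>1\<close>. Since \<open>clifford (a + 1)\<close> is a multiple of the derivative, all zeros are simple.\<close>
lemma clifford_no_common_zero:
  assumes "0 < a" "clifford a y = 0"
  shows "clifford (a + 1) y \<noteq> 0"
proof
  assume "clifford (a + 1) y = 0"
  show False
  proof (cases "y = 0")
    case True
    with assms clifford_pos_nonpos_arg[of a y] show ?thesis by simp
  next
    case False
    have *: "clifford (a + real n) y = 0 \<and> clifford (a + real n + 1) y = 0" for n
    proof (induction n)
      case (Suc n)
      have pos: "0 < a + real n" using assms by simp
      have "y * (clifford (a + real n + 2) y / ((a + real n) * (a + real n + 1))) = 0"
        using clifford_recurrence[OF pos, of y] Suc by simp
      then have "clifford (a + real n + 2) y = 0" using False pos by auto
      with Suc show ?case by (simp add: algebra_simps)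
    qed (use assms \<open>clifford (a + 1) y = 0\<close> in simp)
    obtain n where n: "max 1 (exp \<bar>y\<bar>) < real n" using reals_Archimedean2 by blast
    then have n1: "1 < real n" by (simp only: max_less_iff_conj)
    from n have "exp \<bar>y\<bar> / (a + real n) < 1" using assms by (simp add: field_simps)
    moreover have "\<bar>clifford (a + real n) y - 1\<bar> \<le> exp \<bar>y\<bar> / (a + real n)"
      using n1 assms(1) by (intro clifford_near_one) linarith
    ultimately show False using *[of n] by simp
  qed
qed

lemma clifford_partial_fractions:
  assumes "0 < a"
  obtains t d where "\<And>k. 0 \<le> t k" "summable t" "0 \<le> d"
    "\<And>y k. clifford a y \<noteq> 0 \<Longrightarrow> t k * y \<noteq> 1"
    "\<And>y. clifford a y \<noteq> 0 \<Longrightarrow> summable (\<lambda>k. t k / (1 - t k * y))"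
    "\<And>y. clifford a y \<noteq> 0 \<Longrightarrow> summable (\<lambda>k. (t k / (1 - t k * y))\<^sup>2)"
    "\<And>y. clifford a y \<noteq> 0 \<Longrightarrow>
       clifford (a + 1) y / a = clifford a y * (d + (\<Sum>k. t k / (1 - t k * y)))"
    "\<And>y. clifford a y \<noteq> 0 \<Longrightarrow>
       (clifford (a + 1) y / a)\<^sup>2 - clifford a y * (clifford (a + 2) y / (a * (a + 1)))
         = (clifford a y)\<^sup>2 * (\<Sum>k. (t k / (1 - t k * y))\<^sup>2)"
proof -
  have "\<forall>N. \<exists>u. (\<forall>k. 0 \<le> u k) \<and> antimono u \<and> (\<forall>k\<ge>N. u k = 0) \<and>
    (\<forall>m. coeff (\<Prod>k<N. [:1, - u k:]) m = approx_coeff a N m)"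
    using approx_factor[OF assms] by blast
  then obtain s where s: "\<And>N. (\<forall>k. 0 \<le> s N k) \<and> antimono (s N) \<and> (\<forall>k\<ge>N. s N k = 0) \<and>
    (\<forall>m. coeff (\<Prod>k<N. [:1, - s N k:]) m = approx_coeff a N m)"
    by metis
  interpret hyperbolic_limit s "approx_bound a" "clifford_coeff a"
  proof
    fix N m :: nat and y :: real
    show "\<bar>coeff (\<Prod>k<N. [:1, - s N k:]) m\<bar> \<le> approx_bound a m"
      using s abs_approx_coeff_le[OF assms] by (simp add: approx_bound_def)
    show "(\<lambda>N. coeff (\<Prod>k<N. [:1, - s N k:]) m) \<longlonglongrightarrow> clifford_coeff a m"
      using s approx_coeff_tendsto[OF assms] by (simp add: clifford_coeff_def)
    show "summable (\<lambda>m. approx_bound a m * y ^ m)" by (rule approx_bound_summable[OF assms])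
  qed (use s in auto)
  have eqs: "h y = clifford a y" "h1 y = - clifford (a + 1) y / a"
      "h2 y = clifford (a + 2) y / (a * (a + 1))" for y
    unfolding h_def h1_def h2_def diffs_clifford_series[OF assms] diffs2_clifford_series[OF assms]
    by (simp_all add: clifford_def)
  show ?thesis
    using partial_fractions unfolding eqs
    by (elim exE conjE) (rule that, auto)
qed

text \<open>At a simple zero \<open>x\<close> of \<open>h\<close> the function \<open>(h1\<^sup>2 - h * h2) / h\<^sup>2\<close> has a double pole with leading
coefficient \<open>1\<close>. In the series, each \<open>k\<close> with \<open>t k = 1 / x\<close> contributes \<open>1 / (y - x)\<^sup>2\<close>, and the
remaining terms stay bounded near \<open>x\<close>.\<close>
lemma double_pole_count:
  fixes t :: "nat \<Rightarrow> real" and h h1 h2 :: "real \<Rightarrow> real"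
  assumes t0: "\<And>k. 0 \<le> t k" and sumt: "summable t" and "0 < x"
    and deriv: "(h has_real_derivative h1 x) (at x)" and c1: "isCont h1 x" and c2: "isCont h2 x"
    and hx: "h x = 0" and h1x: "h1 x \<noteq> 0"
    and sm: "\<And>y. h y \<noteq> 0 \<Longrightarrow> summable (\<lambda>k. (t k / (1 - t k * y))\<^sup>2)"
    and eq: "\<And>y. h y \<noteq> 0 \<Longrightarrow> (h1 y)\<^sup>2 - h y * h2 y = (h y)\<^sup>2 * (\<Sum>k. (t k / (1 - t k * y))\<^sup>2)"
  shows "card {k. t k * x = 1} = 1"
proof -
  define K where "K = {k. t k * x = 1}"
  have "(\<lambda>k. t k * x) \<longlonglongrightarrow> 0"
    by (simp add: tendsto_mult_left_zero summable_LIMSEQ_zero[OF sumt])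
  then have "\<forall>\<^sub>F k in sequentially. t k * x < 1 / 2"
    by (rule order_tendstoD) auto
  then obtain M where M: "\<And>k. M \<le> k \<Longrightarrow> t k * x < 1 / 2"
    unfolding eventually_sequentially by blast
  have "K \<subseteq> {..<M}" using M unfolding K_def by (force simp: not_less[symmetric])
  then have finK: "finite K" by (rule finite_subset) simp
  \<comment> \<open>Since \<open>t k\<close> tends to zero, the factors that do not vanish at \<open>x\<close> are bounded away from zero.\<close>
  obtain \<delta> where \<delta>: "0 < \<delta>" "\<And>k. k \<notin> K \<Longrightarrow> 2 * \<delta> \<le> \<bar>1 - t k * x\<bar>"
  proof -
    define D where "D = insert (1 / 2) ((\<lambda>k. \<bar>1 - t k * x\<bar>) ` ({..<M} - K))"
    have fin: "finite D" "D \<noteq> {}" by (auto simp: D_def)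
    have "\<forall>r\<in>D. 0 < r" by (auto simp: D_def K_def)
    then have pos: "0 < Min D" using fin by simp
    have le: "Min D \<le> \<bar>1 - t k * x\<bar>" if "k \<notin> K" for k
    proof (cases "k < M")
      case True
      then show ?thesis using that fin by (intro Min_le) (auto simp: D_def)
    next
      case False
      then have "t k * x < 1 / 2" using M by simp
      moreover have "Min D \<le> 1 / 2" using fin by (intro Min_le) (auto simp: D_def)
      ultimately show ?thesis by linarith
    qed
    show ?thesis by (rule that[of "Min D / 2"]) (use pos le in auto)
  qed
  define C where "C = suminf t + 1"
  have tC: "t k \<le> C" for k
    using sum_le_suminf[OF sumt, of "{k}"] t0 by (simp add: C_def)
  have C: "0 < C" using suminf_nonneg[OF sumt t0] by (simp add: C_def)
  define g where "g k y = (if k \<in> K then 0 else (t k / (1 - t k * y))\<^sup>2)" for k y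
  define B where "B = C / \<delta>\<^sup>2 * suminf t"
  have gB: "0 \<le> (\<Sum>k. g k y) \<and> (\<Sum>k. g k y) \<le> B" if y: "\<bar>y - x\<bar> < \<delta> / C" for y
  proof -
    have gle: "g k y \<le> C / \<delta>\<^sup>2 * t k" for k
    proof (cases "k \<in> K")
      case False
      have "t k * \<bar>y - x\<bar> \<le> C * (\<delta> / C)" using y tC t0 C by (intro mult_mono) auto
      then have "\<bar>t k * y - t k * x\<bar> \<le> \<delta>"
        using C t0[of k] by (simp add: abs_mult right_diff_distrib[symmetric])
      then have "\<delta> \<le> \<bar>1 - t k * y\<bar>" using \<delta>(2)[OF False] by linarith
      then have "\<delta>\<^sup>2 \<le> (1 - t k * y)\<^sup>2" using \<delta>(1) by (metis less_imp_le power2_abs power_mono)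
      moreover have "(t k)\<^sup>2 \<le> C * t k" unfolding power2_eq_square by (intro mult_right_mono tC t0)
      ultimately have "(t k)\<^sup>2 / (1 - t k * y)\<^sup>2 \<le> C * t k / \<delta>\<^sup>2"
        using \<delta>(1) C t0 by (intro frac_le) auto
      then show ?thesis using False by (simp add: g_def power_divide)
    qed (use C t0 in \<open>auto simp: g_def\<close>)
    have g0: "0 \<le> g k y" for k by (simp add: g_def)
    have sb: "summable (\<lambda>k. C / \<delta>\<^sup>2 * t k)" by (rule summable_mult[OF sumt])
    have sg: "summable (\<lambda>k. g k y)"
      by (rule summable_comparison_test'[OF sb, of 0]) (use g0 gle in auto)
    show ?thesis
      using suminf_nonneg[OF sg g0] suminf_le[OF gle sg sb] suminf_mult[OF sumt, of "C / \<delta>\<^sup>2"]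
      by (simp add: B_def)
  qed
  define E where "E y = (y - x)\<^sup>2 * (\<Sum>k. (t k / (1 - t k * y))\<^sup>2)" for y
  have quot: "((\<lambda>y. h y / (y - x)) \<longlongrightarrow> h1 x) (at x)"
    using deriv hx by (simp add: has_field_derivative_iff)
  then have hnz: "\<forall>\<^sub>F y in at x. h y / (y - x) \<noteq> 0"
    using h1x tendsto_imp_eventually_ne by blast
  have Eeq: "\<forall>\<^sub>F y in at x. ((h1 y)\<^sup>2 - h y * h2 y) / (h y / (y - x))\<^sup>2 = E y"
    using hnz
  proof eventually_elim
    case (elim y)
    then have "h y \<noteq> 0" "y \<noteq> x" by auto
    then show ?case using eq[of y] by (simp add: E_def power_divide)
  qed
  have "isCont h x" using deriv by (rule DERIV_isCont)
  then have "((\<lambda>y. ((h1 y)\<^sup>2 - h y * h2 y) / (h y / (y - x))\<^sup>2)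
      \<longlongrightarrow> ((h1 x)\<^sup>2 - h x * h2 x) / (h1 x)\<^sup>2) (at x)"
    using c1 c2 h1x by (intro tendsto_intros quot) (auto simp: isCont_def)
  then have E1: "(E \<longlongrightarrow> 1) (at x)"
    using Lim_transform_eventually[OF _ Eeq] h1x hx by simp
  have near: "\<forall>\<^sub>F y in at x. \<bar>y - x\<bar> < \<delta> / C"
    using \<delta>(1) C by (auto simp: eventually_at dist_real_def intro!: exI[of _ "\<delta> / C"])
  have bound: "\<forall>\<^sub>F y in at x. norm (E y - real (card K)) \<le> (y - x)\<^sup>2 * B"
    using hnz near
  proof eventually_elim
    case (elim y)
    then have hy: "h y \<noteq> 0" "y \<noteq> x" by auto
    have inK: "(t k / (1 - t k * y))\<^sup>2 = 1 / (y - x)\<^sup>2" if "k \<in> K" for k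
    proof -
      have tk: "t k = 1 / x" using that \<open>0 < x\<close> by (simp add: K_def field_simps)
      have "1 - t k * y = (x - y) / x" unfolding tk using \<open>0 < x\<close> by (simp add: diff_divide_distrib)
      then have "t k / (1 - t k * y) = 1 / (x - y)" unfolding tk using \<open>0 < x\<close> by simp
      then show ?thesis by (simp add: power_divide power2_commute)
    qed
    define f where "f k = (if k \<in> K then 1 / (y - x)\<^sup>2 else 0)" for k
    have fs: "f sums (\<Sum>k\<in>K. 1 / (y - x)\<^sup>2)"
      unfolding f_def using finK by (rule sums_If_finite_set)
    have split: "(t k / (1 - t k * y))\<^sup>2 = f k + g k y" for k
      using inK by (auto simp: f_def g_def)
    have sg: "summable (\<lambda>k. g k y)"
      using summable_diff[OF sm[OF hy(1)] sums_summable[OF fs]] unfolding split by simp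
    have "(\<Sum>k. (t k / (1 - t k * y))\<^sup>2) = real (card K) / (y - x)\<^sup>2 + (\<Sum>k. g k y)"
      unfolding split using suminf_add[OF sums_summable[OF fs] sg] sums_unique[OF fs] by simp
    then have "E y - real (card K) = (y - x)\<^sup>2 * (\<Sum>k. g k y)"
      using hy(2) by (simp add: E_def distrib_left)
    then show ?case using gB[OF elim(2)] by (simp add: abs_mult mult_left_mono)
  qed
  have "((\<lambda>y. (y - x)\<^sup>2 * B) \<longlongrightarrow> (x - x)\<^sup>2 * B) (at x)" by (intro tendsto_intros)
  then have "((\<lambda>y. E y - real (card K)) \<longlongrightarrow> 0) (at x)"
    by (intro Lim_null_comparison[OF bound]) simp
  moreover have "((\<lambda>y. E y - real (card K)) \<longlongrightarrow> 1 - real (card K)) (at x)"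
    by (intro tendsto_intros E1)
  ultimately have "1 - real (card K) = 0"
    using tendsto_unique[OF at_neq_bot] by blast
  then show ?thesis by (simp add: K_def)
qed

text \<open>The differential equation at \<open>y = - T\<close>, written as a Riccati equation for the logarithmic
derivative, settles what the limit process leaves open. As \<open>T\<close> tends to infinity it forces the
escaped mass \<open>d\<close> to vanish, and it also excludes that only finitely many zeros exist.\<close>
lemma clifford_reciprocal_zeros:
  assumes a: "0 < a"
  obtains t where "\<And>k. 0 \<le> t k" "summable t" "infinite {k. 0 < t k}"
    "bij_betw (\<lambda>k. 1 / t k) {k. 0 < t k} {x. 0 < x \<and> clifford a x = 0}"
    "\<And>y. clifford a y \<noteq> 0 \<Longrightarrow> (\<forall>k. t k * y \<noteq> 1) \<and>
       (\<lambda>k. t k / (1 - t k * y)) sums (clifford (a + 1) y / (a * clifford a y))"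
    "\<And>y. clifford a y \<noteq> 0 \<Longrightarrow>
       (\<lambda>k. (t k / (1 - t k * y))\<^sup>2) sums
         ((clifford (a + 1) y / (a * clifford a y))\<^sup>2 - clifford (a + 2) y / (a * (a + 1)) / clifford a y)"
proof -
  obtain t d where t0: "\<And>k. 0 \<le> t k" and sumt: "summable t" and d0: "0 \<le> d"
    and ne1: "\<And>y k. clifford a y \<noteq> 0 \<Longrightarrow> t k * y \<noteq> 1"
    and sm1: "\<And>y. clifford a y \<noteq> 0 \<Longrightarrow> summable (\<lambda>k. t k / (1 - t k * y))"
    and sm2: "\<And>y. clifford a y \<noteq> 0 \<Longrightarrow> summable (\<lambda>k. (t k / (1 - t k * y))\<^sup>2)"
    and e1: "\<And>y. clifford a y \<noteq> 0 \<Longrightarrow>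
       clifford (a + 1) y / a = clifford a y * (d + (\<Sum>k. t k / (1 - t k * y)))"
    and e2: "\<And>y. clifford a y \<noteq> 0 \<Longrightarrow>
       (clifford (a + 1) y / a)\<^sup>2 - clifford a y * (clifford (a + 2) y / (a * (a + 1)))
         = (clifford a y)\<^sup>2 * (\<Sum>k. (t k / (1 - t k * y))\<^sup>2)"
  proof (rule clifford_partial_fractions[OF a], goal_cases)
    case (1 t d)
    show ?case by (rule that[of t d]) (fact 1)+
  qed
  define S1 S2 where "S1 y = (\<Sum>k. t k / (1 - t k * y))" and "S2 y = (\<Sum>k. (t k / (1 - t k * y))\<^sup>2)" for y
  have v: "clifford (a + 1) y / (a * clifford a y) = d + S1 y" if "clifford a y \<noteq> 0" for y
    using e1[OF that] that a by (simp add: S1_def field_simps)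
  have w: "clifford (a + 2) y / (a * (a + 1)) / clifford a y = (d + S1 y)\<^sup>2 - S2 y" if "clifford a y \<noteq> 0" for y
  proof -
    have "(clifford a y * (d + S1 y))\<^sup>2 - clifford a y * (clifford (a + 2) y / (a * (a + 1))) = (clifford a y)\<^sup>2 * S2 y"
      using e1[OF that] e2[OF that] by (simp add: S1_def S2_def)
    then have "clifford a y * (clifford (a + 2) y / (a * (a + 1))) = (clifford a y)\<^sup>2 * ((d + S1 y)\<^sup>2 - S2 y)"
      by (simp add: power_mult_distrib right_diff_distrib)
    moreover have "X / Y = Z" if "Y * X = Y\<^sup>2 * Z" "Y \<noteq> 0" for X Y Z :: real
      using that by (simp add: power2_eq_square)
    ultimately show ?thesis using that by blast
  qed
  \<comment> \<open>The value \<open>d + S1 y\<close> is minus the logarithmic derivative of \<open>clifford a\<close> at \<open>y\<close>.\<close>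
  have riccati: "T * (d + S1 (-T))\<^sup>2 + a * (d + S1 (-T)) = 1 + T * S2 (-T)" if "0 < T" for T
  proof -
    have nz: "clifford a (-T) \<noteq> 0" using clifford_pos_nonpos_arg[OF a, of "-T"] that by simp
    have "-T * (clifford (a + 2) (-T) / (a * (a + 1)) / clifford a (-T))
        = clifford (a + 1) (-T) / clifford a (-T) - 1"
    proof -
      have "-T * (X / Y) = Z / Y - 1" if "-T * X = Z - Y" "Y \<noteq> 0" for X Y Z
        using that by (simp add: diff_divide_distrib flip: minus_divide_left)
      then show ?thesis using clifford_recurrence[OF a, of "-T"] nz by blast
    qed
    also have "clifford (a + 1) (-T) / clifford a (-T) = a * (d + S1 (-T))"
      unfolding v[OF nz, symmetric] using a by simp
    finally show ?thesis unfolding w[OF nz] by (simp add: algebra_simps)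
  qed
  have den: "0 < 1 + t k * T" if "0 < T" for k T
    using t0[of k] that by (simp add: add_pos_nonneg)
  have S1T: "0 \<le> S1 (-T)" if "0 < T" for T
    unfolding S1_def
    using clifford_pos_nonpos_arg[OF a, of "-T"] that den[OF that] t0
    by (intro suminf_nonneg sm1) (auto intro!: divide_nonneg_nonneg less_imp_le)
  have d: "d = 0"
  proof (rule ccontr)
    assume "d \<noteq> 0"
    then have dpos: "0 < d\<^sup>2" by simp
    \<comment> \<open>The Riccati equation yields \<open>T * d\<^sup>2 \<le> 1 + suminf t\<close>; this \<open>T\<close> violates it.\<close>
    define T where "T = (suminf t + 2) / d\<^sup>2"
    have st: "0 \<le> suminf t" by (rule suminf_nonneg[OF sumt t0])
    have T: "0 < T" using dpos st by (simp add: T_def)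
    have nz: "clifford a (-T) \<noteq> 0" using clifford_pos_nonpos_arg[OF a, of "-T"] T by simp
    have trm: "T * (t k / (1 - t k * - T))\<^sup>2 \<le> t k" for k
    proof -
      have u: "0 \<le> t k * T" using t0 T by simp
      have "T * (t k / (1 - t k * - T))\<^sup>2 = t k * (t k * T / (1 + t k * T)\<^sup>2)"
        by (simp add: power2_eq_square)
      also have "t k * T / (1 + t k * T)\<^sup>2 \<le> 1"
      proof -
        have "t k * T \<le> (1 + t k * T)\<^sup>2"
          using u zero_le_power2[of "t k * T"]
          unfolding power2_sum power_one mult_1_right by linarith
        moreover have "0 < (1 + t k * T)\<^sup>2" using u by simp
        ultimately show ?thesis by (simp only: divide_le_eq_1_pos)
      qed
      then have "t k * (t k * T / (1 + t k * T)\<^sup>2) \<le> t k * 1"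
        using t0 by (rule mult_left_mono)
      finally show ?thesis by simp
    qed
    have "T * S2 (-T) = (\<Sum>k. T * (t k / (1 - t k * - T))\<^sup>2)"
      unfolding S2_def by (rule suminf_mult[OF sm2[OF nz], symmetric])
    also have "\<dots> \<le> suminf t" by (intro suminf_le trm summable_mult sm2 nz sumt)
    finally have "T * S2 (-T) \<le> suminf t" .
    moreover have "d\<^sup>2 \<le> (d + S1 (-T))\<^sup>2" using d0 S1T[OF T] by (intro power_mono) auto
    then have "T * d\<^sup>2 \<le> T * (d + S1 (-T))\<^sup>2" using T by (intro mult_left_mono) auto
    moreover have "0 \<le> a * (d + S1 (-T))" using a d0 S1T[OF T] by simp
    ultimately have "T * d\<^sup>2 \<le> 1 + suminf t" using riccati[OF T] by linarith
    then show False using dpos by (simp add: T_def)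
  qed
  have inf: "infinite {k. 0 < t k}"
  proof
    assume fin: "finite {k. 0 < t k}"
    define n where "n = real (card {k. 0 < t k})"
    \<comment> \<open>With \<open>n\<close> terms, \<open>S1 (-T) \<le> n / T\<close>, and the left side of the Riccati equation drops below \<open>1\<close>.\<close>
    define T where "T = n\<^sup>2 + a * n + 1"
    have n0: "0 \<le> n" by (simp add: n_def)
    have T: "0 < T" using a n0 by (simp add: T_def add_nonneg_pos)
    have "S1 (-T) = (\<Sum>k | 0 < t k. t k / (1 - t k * - T))"
      unfolding S1_def using t0 by (intro suminf_finite fin) (auto simp: order_less_le)
    also have "\<dots> \<le> (\<Sum>k | 0 < t k. 1 / T)"
      using T den[OF T] by (intro sum_mono) (auto simp: divide_le_eq le_divide_eq field_simps)
    finally have le: "S1 (-T) \<le> n / T" by (simp add: n_def)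
    have nz: "clifford a (-T) \<noteq> 0" using clifford_pos_nonpos_arg[OF a, of "-T"] T by simp
    have "0 \<le> T * S2 (-T)" unfolding S2_def
      using T suminf_nonneg[OF sm2[OF nz]] by simp
    then have "1 \<le> T * (S1 (-T))\<^sup>2 + a * S1 (-T)" using riccati[OF T] d by simp
    also have "\<dots> \<le> T * (n / T)\<^sup>2 + a * (n / T)"
      using le S1T[OF T] T a by (intro add_mono mult_left_mono power_mono) auto
    also have "\<dots> = (n\<^sup>2 + a * n) / T" using T by (simp add: power2_eq_square add_divide_distrib)
    also have "\<dots> < 1" using T by (simp add: T_def)
    finally show False by simp
  qed
  have one: "card {k. t k * x = 1} = 1" if "0 < x" "clifford a x = 0" for x
  proof (rule double_pole_count[of t x "clifford a" "\<lambda>y. - clifford (a + 1) y / a"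
        "\<lambda>y. clifford (a + 2) y / (a * (a + 1))"])
    show "isCont (\<lambda>y. - clifford (a + 1) y / a) x"
      using a by (intro continuous_intros isCont_clifford) auto
    show "isCont (\<lambda>y. clifford (a + 2) y / (a * (a + 1))) x"
      using a by (intro continuous_intros isCont_clifford) auto
    show "- clifford (a + 1) x / a \<noteq> 0" using clifford_no_common_zero[OF a that(2)] a by simp
    show "(- clifford (a + 1) y / a)\<^sup>2 - clifford a y * (clifford (a + 2) y / (a * (a + 1)))
        = (clifford a y)\<^sup>2 * (\<Sum>k. (t k / (1 - t k * y))\<^sup>2)" if "clifford a y \<noteq> 0" for y
      using e2[OF that] by simp
  qed (use t0 sumt that sm2 clifford_has_derivative[OF a] in auto)
  have zero: "clifford a (1 / t k) = 0" if "0 < t k" for k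
    using ne1[of "1 / t k" k] that by auto
  have bij: "bij_betw (\<lambda>k. 1 / t k) {k. 0 < t k} {x. 0 < x \<and> clifford a x = 0}"
  proof (rule bij_betwI')
    fix j k assume jk: "j \<in> {k. 0 < t k}" "k \<in> {k. 0 < t k}"
    show "(1 / t j = 1 / t k) = (j = k)"
    proof
      assume eq: "1 / t j = 1 / t k"
      have "card {i. t i * (1 / t k) = 1} = 1" using jk zero by (intro one) auto
      then obtain i where i: "{i. t i * (1 / t k) = 1} = {i}" by (auto simp: card_1_singleton_iff)
      have "j \<in> {i. t i * (1 / t k) = 1}" "k \<in> {i. t i * (1 / t k) = 1}" using eq jk by auto
      then show "j = k" unfolding i by simp
    qed simp
  next
    fix x assume x: "x \<in> {x. 0 < x \<and> clifford a x = 0}"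
    then have "{k. t k * x = 1} \<noteq> {}" using one[of x] by force
    then obtain k where k: "t k * x = 1" by blast
    moreover have "0 < t k" using k x t0[of k] by (auto simp: order_less_le)
    ultimately show "\<exists>k\<in>{k. 0 < t k}. x = 1 / t k" by (intro bexI[of _ k]) (auto simp: field_simps)
  qed (use zero in auto)
  show ?thesis
  proof (rule that[OF t0 sumt inf bij])
    fix y assume y: "clifford a y \<noteq> 0"
    show "(\<forall>k. t k * y \<noteq> 1) \<and> (\<lambda>k. t k / (1 - t k * y)) sums (clifford (a + 1) y / (a * clifford a y))"
      using ne1[OF y] summable_sums[OF sm1[OF y]] v[OF y] d by (simp add: S1_def)
    show "(\<lambda>k. (t k / (1 - t k * y))\<^sup>2) sums
         ((clifford (a + 1) y / (a * clifford a y))\<^sup>2 - clifford (a + 2) y / (a * (a + 1)) / clifford a y)"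
      using summable_sums[OF sm2[OF y]] unfolding v[OF y] w[OF y] S2_def by simp
  qed
qed

text \<open>At \<open>b\<close> the derivative of \<open>clifford a\<close> vanishes, so the first-order sum is \<open>0\<close>, and the differential
equation gives \<open>1 / b\<close> for the second-order sum. In terms of \<open>t = 1 / x\<close>, the summand \<open>x / (b - x)\<^sup>2\<close>
is the first-order term plus \<open>b\<close> times the second-order term.\<close>
lemma clifford_zero_sum:
  assumes a: "0 < a" and b: "0 < b" "clifford (a + 1) b = 0"
  shows "((\<lambda>x. x / (b - x)\<^sup>2) has_sum 1) {x. 0 < x \<and> clifford a x = 0}"
proof -
  obtain t where t0: "\<And>k. 0 \<le> t k" and "summable t" and "infinite {k. 0 < t k}"
    and bij: "bij_betw (\<lambda>k. 1 / t k) {k. 0 < t k} {x. 0 < x \<and> clifford a x = 0}"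
    and t1: "\<And>y. clifford a y \<noteq> 0 \<Longrightarrow> (\<forall>k. t k * y \<noteq> 1) \<and>
       (\<lambda>k. t k / (1 - t k * y)) sums (clifford (a + 1) y / (a * clifford a y))"
    and t2: "\<And>y. clifford a y \<noteq> 0 \<Longrightarrow>
       (\<lambda>k. (t k / (1 - t k * y))\<^sup>2) sums
         ((clifford (a + 1) y / (a * clifford a y))\<^sup>2 - clifford (a + 2) y / (a * (a + 1)) / clifford a y)"
  proof (rule clifford_reciprocal_zeros[OF a], goal_cases)
    case (1 t)
    show ?case by (rule that[of t]) (fact 1)+
  qed
  have nz: "clifford a b \<noteq> 0" using clifford_no_common_zero[OF a] b by blast
  have div: "X / Y = - 1 / b" if "b * X = - Y" "Y \<noteq> 0" for X Y
    using that b(1) by (simp add: field_simps)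
  have c2: "clifford (a + 2) b / (a * (a + 1)) / clifford a b = - 1 / b"
    using clifford_recurrence[OF a, of b] b(2) by (intro div nz) linarith
  have "(\<lambda>k. t k / (1 - t k * b) + b * (t k / (1 - t k * b))\<^sup>2) sums (0 + b * (1 / b))"
    using t1[OF nz] t2[OF nz] b c2 by (intro sums_add sums_mult) auto
  moreover have "t k / (1 - t k * b) + b * (t k / (1 - t k * b))\<^sup>2 = t k / (1 - t k * b)\<^sup>2" for k
  proof -
    have "1 - t k * b \<noteq> 0" using t1[OF nz] by simp
    moreover have "T / w + b * (T / w)\<^sup>2 = (T * w + b * T\<^sup>2) / w\<^sup>2" if "w \<noteq> 0" for T w :: real
      using that by (simp add: power2_eq_square add_divide_distrib)
    ultimately have "t k / (1 - t k * b) + b * (t k / (1 - t k * b))\<^sup>2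
        = (t k * (1 - t k * b) + b * (t k)\<^sup>2) / (1 - t k * b)\<^sup>2" by blast
    also have "t k * (1 - t k * b) + b * (t k)\<^sup>2 = t k" by (simp add: power2_eq_square algebra_simps)
    finally show ?thesis .
  qed
  ultimately have "(\<lambda>k. t k / (1 - t k * b)\<^sup>2) sums 1" using b by simp
  then have "((\<lambda>k. t k / (1 - t k * b)\<^sup>2) has_sum 1) UNIV"
    using t0 by (intro sums_nonneg_imp_has_sum) auto
  also have "?this \<longleftrightarrow> ((\<lambda>k. (1 / t k) / (b - 1 / t k)\<^sup>2) has_sum 1) {k. 0 < t k}"
  proof (rule has_sum_cong_neutral)
    fix k assume "k \<in> UNIV \<inter> {k. 0 < t k}"
    then have t: "0 < t k" by simp
    then have "b - 1 / t k = - (1 - t k * b) / t k" by (simp add: field_simps)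
    then have "(b - 1 / t k)\<^sup>2 = (1 - t k * b)\<^sup>2 / (t k)\<^sup>2"
      by (simp only: power_divide power2_minus)
    then show "t k / (1 - t k * b)\<^sup>2 = (1 / t k) / (b - 1 / t k)\<^sup>2"
      using t by (simp add: power2_eq_square)
  qed (use t0 in \<open>auto simp: order_less_le\<close>)
  also have "\<dots> \<longleftrightarrow> ((\<lambda>x. x / (b - x)\<^sup>2) has_sum 1) {x. 0 < x \<and> clifford a x = 0}"
    by (rule has_sum_reindex_bij_betw[OF bij])
  finally show ?thesis .
qed

lemma clifford_zeros_infinite:
  assumes "0 < a"
  shows "infinite {x. 0 < x \<and> clifford a x = 0}"
proof (rule clifford_reciprocal_zeros[OF assms], goal_cases)
  case (1 t)
  then show ?case using bij_betw_finite by blast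
qed

lemma clifford_zeros_locally_finite:
  assumes a: "0 < a"
  shows "finite {x. 0 < x \<and> clifford a x = 0 \<and> x \<le> R}"
proof -
  obtain t where sumt: "summable t"
    and bij: "bij_betw (\<lambda>k. 1 / t k) {k. 0 < t k} {x. 0 < x \<and> clifford a x = 0}"
  proof (rule clifford_reciprocal_zeros[OF a], goal_cases)
    case (1 t)
    show ?case by (rule that[of t]) (fact 1)+
  qed
  have "t \<longlonglongrightarrow> 0" by (rule summable_LIMSEQ_zero[OF sumt])
  then have "\<forall>\<^sub>F k in sequentially. t k < 1 / max R 1"
    by (rule order_tendstoD) auto
  then obtain M where M: "\<And>k. M \<le> k \<Longrightarrow> t k < 1 / max R 1"
    unfolding eventually_sequentially by blast
  have "{x. 0 < x \<and> clifford a x = 0 \<and> x \<le> R} \<subseteq> (\<lambda>k. 1 / t k) ` {..<M}"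
  proof
    fix x assume x: "x \<in> {x. 0 < x \<and> clifford a x = 0 \<and> x \<le> R}"
    then have "x \<in> (\<lambda>k. 1 / t k) ` {k. 0 < t k}" using bij_betw_imp_surj_on[OF bij] by auto
    then obtain k where k: "0 < t k" "x = 1 / t k" by auto
    have "1 / t k \<le> max R 1" using x k by auto
    then have "1 / max R 1 \<le> t k" using k(1) by (simp add: field_simps)
    then have "k < M" using M[of k] by (meson not_le)
    then show "x \<in> (\<lambda>k. 1 / t k) ` {..<M}" using k by auto
  qed
  then show ?thesis by (rule finite_subset) simp
qed

section \<open>Zeros of the Bessel function\<close>
lemma bessel_J_eq_clifford:
  assumes "-1 < \<mu>" "0 < x"
  shows "bessel_J \<mu> x = (x / 2) powr \<mu> * rGamma (\<mu> + 1) * clifford (\<mu> + 1) (x\<^sup>2 / 4)"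
proof -
  have "(-1) ^ m * rGamma (real m + \<mu> + 1) / fact m * (x / 2) powr (2 * real m + \<mu>)
      = (x / 2) powr \<mu> * rGamma (\<mu> + 1) * (clifford_coeff (\<mu> + 1) m * (x\<^sup>2 / 4) ^ m)" for m
  proof -
    have p: "pochhammer (\<mu> + 1) m > 0" using assms by (intro pochhammer_pos) auto
    have "rGamma (real m + \<mu> + 1) = rGamma (\<mu> + 1) / pochhammer (\<mu> + 1) m"
      using pochhammer_rGamma[of "\<mu> + 1" m] p by (simp add: add_ac)
    moreover have "(x / 2) powr (2 * real m + \<mu>) = (x / 2) powr \<mu> * (x\<^sup>2 / 4) ^ m"
    proof -
      have "(x / 2) powr (2 * real m) = (x / 2) ^ (2 * m)"
        using assms powr_realpow[of "x / 2" "2 * m"] by simp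
      also have "\<dots> = (x\<^sup>2 / 4) ^ m" by (simp add: power_mult power_divide)
      finally show ?thesis by (simp add: powr_add)
    qed
    ultimately show ?thesis by (simp add: clifford_coeff_def mult_ac)
  qed
  then show ?thesis
    unfolding bessel_J_def clifford_def
    using assms by (simp add: suminf_mult clifford_summable)
qed

lemma bessel_J_eq_0_iff:
  assumes "-1 < \<mu>" "0 < x"
  shows "bessel_J \<mu> x = 0 \<longleftrightarrow> clifford (\<mu> + 1) (x\<^sup>2 / 4) = 0"
proof -
  have "rGamma (\<mu> + 1) \<noteq> 0"
    using assms by (auto simp: rGamma_eq_zero_iff elim!: nonpos_Ints_cases)
  then show ?thesis using assms by (simp add: bessel_J_eq_clifford)
qed

text \<open>Local finiteness makes each least element exist, and infinitude keeps the recursion from running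
out of elements, where \<open>LEAST\<close> would be arbitrary.\<close>
lemma least_enumeration:
  fixes e :: "nat \<Rightarrow> real" and P :: "real \<Rightarrow> bool"
  defines "W \<equiv> {x. e 0 < x \<and> P x}"
  assumes inf: "infinite W" and fin: "\<And>R. finite {x \<in> W. x \<le> R}"
    and suc: "\<And>n. e (Suc n) = (LEAST x. e n < x \<and> P x)"
  shows "bij_betw e {1..} W"
proof -
  have step': "e n < e (Suc n) \<and> e (Suc n) \<in> W \<and> (\<forall>x\<in>W. e n < x \<longrightarrow> e (Suc n) \<le> x)" if n: "e 0 \<le> e n" for n
  proof -
    have "infinite (W - {x \<in> W. x \<le> e n})" using inf fin by (simp add: Diff_infinite_finite)
    then obtain x0 where x0: "x0 \<in> W" "e n < x0"
      by (metis (no_types, lifting) Diff_iff ex_in_conv finite.emptyI mem_Collect_eq not_le)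
    define D where "D = {x \<in> W. x \<le> x0 \<and> e n < x}"
    have "finite D" by (rule finite_subset[OF _ fin[of x0]]) (auto simp: D_def)
    moreover have "x0 \<in> D" using x0 by (simp add: D_def)
    ultimately have D: "finite D" "D \<noteq> {}" by auto
    have min: "Min D \<in> W \<and> e n < Min D" using Min_in[OF D] by (simp add: D_def)
    have le: "Min D \<le> x" if "x \<in> W" "e n < x" for x
    proof (cases "x \<le> x0")
      case True
      then show ?thesis using that D by (intro Min_le) (auto simp: D_def)
    next
      case False
      moreover have "Min D \<le> x0" using x0 D by (intro Min_le) (auto simp: D_def)
      ultimately show ?thesis by simp
    qed
    have "e (Suc n) = Min D"
      unfolding suc by (rule Least_equality) (use min le n in \<open>auto simp: W_def\<close>)
    then show ?thesis using min le by auto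
  qed
  have "e 0 \<le> e n" for n
    by (induction n) (use step' in \<open>fastforce+\<close>)
  note step = step'[OF this]
  then have mono: "strict_mono e" by (simp add: strict_mono_Suc_iff)
  have surj: "x \<in> e ` {1..}" if "x \<in> W" for x
  proof (rule ccontr)
    assume x: "x \<notin> e ` {1..}"
    have "e n < x" for n
    proof (induction n)
      case (Suc n)
      have "e (Suc n) \<noteq> x" using x by auto
      moreover have "e (Suc n) \<le> x" using step[of n] Suc that by blast
      ultimately show ?case by simp
    qed (use that in \<open>simp add: W_def\<close>)
    then have "range (\<lambda>n. e (Suc n)) \<subseteq> {w \<in> W. w \<le> x}" using step less_imp_le by blast
    then have "finite (range (\<lambda>n. e (Suc n)))" using fin finite_subset by blast
    moreover have "inj (\<lambda>n. e (Suc n))" using mono by (auto intro!: injI simp: strict_mono_eq)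
    ultimately show False using finite_imageD infinite_UNIV_nat by blast
  qed
  have "e n \<in> W" if "1 \<le> n" for n using step[of "n - 1"] that by simp
  then show ?thesis unfolding bij_betw_def
    using surj strict_mono_imp_inj_on[OF mono] by (auto intro: inj_on_subset)
qed

lemma bij_betw_bessel_zero:
  assumes "-1 < \<mu>"
  shows "bij_betw (\<lambda>k. (bessel_zero \<mu> k)\<^sup>2 / 4) {1..} {x. 0 < x \<and> clifford (\<mu> + 1) x = 0}"
proof -
  define W where "W = {x. 0 < x \<and> bessel_J \<mu> x = 0}"
  define Z where "Z = {x. 0 < x \<and> clifford (\<mu> + 1) x = 0}"
  have sq: "bij_betw (\<lambda>x. x\<^sup>2 / 4) W Z"
  proof (rule bij_betw_byWitness[where f' = "\<lambda>z. 2 * sqrt z"])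
    show "(\<lambda>x. x\<^sup>2 / 4) ` W \<subseteq> Z" using assms by (auto simp: W_def Z_def bessel_J_eq_0_iff)
    show "(\<lambda>z. 2 * sqrt z) ` Z \<subseteq> W"
      using assms by (auto simp: W_def Z_def bessel_J_eq_0_iff power_mult_distrib)
  qed (auto simp: W_def Z_def real_sqrt_divide power_mult_distrib)
  have inf: "infinite W"
    using bij_betw_finite[OF sq] clifford_zeros_infinite[of "\<mu> + 1"] assms by (simp add: Z_def)
  have fin: "finite {x \<in> W. x \<le> R}" for R
  proof (rule inj_on_finite)
    show "inj_on (\<lambda>x. x\<^sup>2 / 4) {x \<in> W. x \<le> R}"
      by (rule inj_on_subset[OF bij_betw_imp_inj_on[OF sq]]) auto
    show "(\<lambda>x. x\<^sup>2 / 4) ` {x \<in> W. x \<le> R} \<subseteq> {z. 0 < z \<and> clifford (\<mu> + 1) z = 0 \<and> z \<le> R\<^sup>2 / 4}"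
      using bij_betw_imp_surj_on[OF sq] by (auto simp: W_def Z_def power_mono)
    show "finite {z. 0 < z \<and> clifford (\<mu> + 1) z = 0 \<and> z \<le> R\<^sup>2 / 4}"
      using assms by (intro clifford_zeros_locally_finite) auto
  qed
  have "bij_betw (bessel_zero \<mu>) {1..} {x. bessel_zero \<mu> 0 < x \<and> bessel_J \<mu> x = 0}"
    by (rule least_enumeration) (use inf fin in \<open>simp_all add: W_def\<close>)
  then have e: "bij_betw (bessel_zero \<mu>) {1..} W" by (simp add: W_def)
  show "bij_betw (\<lambda>k. (bessel_zero \<mu> k)\<^sup>2 / 4) {1..} {x. 0 < x \<and> clifford (\<mu> + 1) x = 0}"
    using bij_betw_trans[OF e sq] by (simp add: o_def Z_def)
qed

theorem mainTheorem2:
  fixes \<nu> :: real and n :: nat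
  assumes "\<nu> > -1" and "n \<ge> 1"
  shows "((\<lambda>k. (bessel_zero \<nu> k)\<^sup>2
            / ((bessel_zero (\<nu> + 1) n)\<^sup>2 - (bessel_zero \<nu> k)\<^sup>2)\<^sup>2)
          has_sum (1 / 4)) {1..}"
proof -
  define b where "b = (bessel_zero (\<nu> + 1) n)\<^sup>2 / 4"
  have "b \<in> {x. 0 < x \<and> clifford (\<nu> + 1 + 1) x = 0}"
    unfolding b_def using assms by (intro bij_betwE[OF bij_betw_bessel_zero, rule_format]) auto
  then have "((\<lambda>x. x / (b - x)\<^sup>2) has_sum 1) {x. 0 < x \<and> clifford (\<nu> + 1) x = 0}"
    using assms by (intro clifford_zero_sum) auto
  then have "((\<lambda>k. ((bessel_zero \<nu> k)\<^sup>2 / 4) / (b - (bessel_zero \<nu> k)\<^sup>2 / 4)\<^sup>2) has_sum 1) {1..}"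
    by (rule has_sum_reindex_bij_betw[OF bij_betw_bessel_zero[OF assms(1)],
        of "\<lambda>x. x / (b - x)\<^sup>2", THEN iffD2])
  from has_sum_cmult_right[OF this, of "1 / 4"]
  have "((\<lambda>k. 1 / 4 * (((bessel_zero \<nu> k)\<^sup>2 / 4) / (b - (bessel_zero \<nu> k)\<^sup>2 / 4)\<^sup>2)) has_sum (1 / 4)) {1..}"
    by simp
  moreover have "1 / 4 * ((u / 4) / (v / 4 - u / 4)\<^sup>2) = u / (v - u)\<^sup>2" for u v :: real
    by (simp add: power_divide flip: diff_divide_distrib)
  ultimately show ?thesis by (simp only: b_def)
qed

end
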